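(* Let $\alpha\in\mathbb R\setminus\mathbb N$, let $\mathcal F$ be the Fock space and let $\rho_0$ be the representation of $G_0=SL(V_1)\times SL(V_2)\times SL(V_3)$ determined by $\rho_0(\exp(X)):=\exp(d\rho(X))$ for $X\in\mathfrak g_{\bar 0}=\mathfrak{sl}(V_1)\oplus\mathfrak{sl}(V_2)\oplus\mathfrak{sl}(V_3)$. Then for all $f=f(z_1,z_2,z_3,z_4)\in\mathcal F$ and all $k_1,k_2,k_3,a_1,a_3\in\mathbb R$: \begin{align*} \rho_0(K_1(k_1))f &= f\left(z_1,z_2,\cos(k_1)z_3-2^{-1}\sin(k_1)z_4,\,2\sin(k_1)z_3+\cos(k_1)z_4\right),\\ \rho_0(K_2(k_2))f &= \exp(\imath\alpha k_2)\,f\left(\exp(-2\imath k_2)z_1,z_2,\exp(-\imath k_2)z_3,\exp(-\imath k_2)z_4\right),\\ \rho_0(K_3(k_3))f &= \exp(\imath k_3)\,f\left(z_1,\exp(-2\imath k_3)z_2,\exp(-\imath k_3)z_3,\exp(-\imath k_3)z_4\right),\\ \rho_0(A_1(a_1))f &= f\left(z_1,z_2,\exp(-a_1)z_3,\exp(a_1)z_4\right),\\ \rho_0(A_3(a_3))f &= (\cosh(a_3)+\sinh(a_3)z_2)\, f\left(z_1,\tanh(a_3)+\cosh(a_3)^{-2}z_2,\cosh(a_3)^{-1}z_3,\cosh(a_3)^{-1}z_4\right). \end{align*}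
   Context: Conventions: $\mathbb N=\{0,1,2,\dots\}$, $\imath$ is the imaginary unit, $(a)_k=a(a+1)\cdots(a+k-1)$, and $\alpha\in\mathbb R\setminus\mathbb N$ is fixed. Polynomial Fock space: let $\mathcal P(\mathbb C^{2|2})$ be the complex superpolynomials in even variables $z_1,z_2$ and odd variables $z_3,z_4$, and let $F:=\mathcal P(\mathbb C^{2|2})/\mathcal I$, where $\mathcal I$ is the ideal generated by $2z_1z_2+z_3z_4,\ z_2^2,\ z_2z_3,\ z_2z_4$. Every element of $F$ has a unique normal form $p_{1,0}+\sum_{k\ge1}z_1^{k-1}(p_{1,k}z_1+p_{2,k}z_2+p_{3,k}z_3+p_{4,k}z_4)$ (finite sum, $p_{i,k}\in\mathbb C$), i.e. the classes of $z_1^k,z_1^kz_2,z_1^kz_3,z_1^kz_4$ ($k\in\mathbb N$) form a basis. Fock space: $\mathcal F$ is the Hilbert space completion of $F$ for the inner product $(\cdot,\cdot)_S$ for which these basis elements are orthogonal with $(z_1^k,z_1^k)_S=(z_1^kz_2,z_1^kz_2)_S=k!|(-\alpha)_k|$ and $(z_1^kz_3,z_1^kz_3)_S=(z_1^kz_4,z_1^kz_4)_S=2\,k!|(-\alpha)_{k+1}|$. Its elements are the series $f=f_{1,0}+\sum_{k\ge1}z_1^{k-1}(f_{1,k}z_1+f_{2,k}z_2+f_{3,k}z_3+f_{4,k}z_4)$ of finite norm. Substitutions in $f(z_1,z_2,z_3,z_4)$ are made in this normal form, and results are read modulo the relations defining $F$. Groups: $V_1,V_2,V_3$ are copies of $\mathbb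 R^2$; $E_i=\begin{pmatrix}0&1\\0&0\end{pmatrix}$, $F_i=\begin{pmatrix}0&0\\1&0\end{pmatrix}$, $H_i=\begin{pmatrix}1&0\\0&-1\end{pmatrix}$ form the basis of $\mathfrak{sl}(V_i)$; $K_i(k)=\begin{pmatrix}\cos k&-\sin k\\ \sin k&\cos k\end{pmatrix}=\exp(k(F_i-E_i))$, $A_i(a)=\begin{pmatrix}e^a&0\\0&e^{-a}\end{pmatrix}=\exp(aH_i)$ in $SL(V_i)$. Bessel operators (writing $\partial_i=\partial_{z_i}$): $\mathcal B(z_1)=(-\alpha+z_1\partial_1+z_3\partial_3+z_4\partial_4)\partial_1-2\alpha z_2\partial_3\partial_4$ and $\mathcal B(z_2)=(-1+z_2\partial_2+z_3\partial_3+z_4\partial_4)\partial_2-2z_1\partial_3\partial_4$. Infinitesimal action of the even part on $F$: $d\rho(F_1)=2z_3\partial_4$, $d\rho(E_1)=\tfrac12z_4\partial_3$, $d\rho(H_1)=z_4\partial_4-z_3\partial_3$, $d\rho(H_2)=z_1-\mathcal B(z_1)$, $d\rho(H_3)=z_2-\mathcal B(z_2)$, $d\rho(F_2)=-\tfrac{\imath}{2}(z_1+\mathcal B(z_1))-\tfrac{\imath}{2}(-\alpha+2z_1\partial_1+z_3\partial_3+z_4\partial_4)$, $d\rho(E_2)=-\tfrac{\imath}{2}(z_1+\mathcal B(z_1))+\tfrac{\imath}{2}(-\alpha+2z_1\partial_1+z_3\partial_3+z_4\partial_4)$, $d\rho(F_3)=-\tfrac{\imath}{2}(z_2+\mathcal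 B(z_2))-\tfrac{\imath}{2}(-1+2z_2\partial_2+z_3\partial_3+z_4\partial_4)$, $d\rho(E_3)=-\tfrac{\imath}{2}(z_2+\mathcal B(z_2))+\tfrac{\imath}{2}(-1+2z_2\partial_2+z_3\partial_3+z_4\partial_4)$. These operators are well defined on the quotient $F$. Every element of $G_0$ is a finite product of exponentials of elements of $\mathfrak g_{\bar 0}$. *)

theory Defs
  imports "HOL-Analysis.Analysis" "HOL-Computational_Algebra.Polynomial_FPS"
begin

section \<open>Superpolynomials in two even and two odd variables\<close>

text \<open>
  \<open>SPoly a b c d\<close> stands for \<open>a + b z\<^sub>3 + c z\<^sub>4 + d z\<^sub>3 z\<^sub>4\<close>.  A coefficient in
  \<open>\<complex>[z\<^sub>1, z\<^sub>2]\<close> is a polynomial in \<open>z\<^sub>2\<close> (outer variable) over the polynomials in \<open>z\<^sub>1\<close>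
  (inner variable).
\<close>

datatype spoly = SPoly (sp0: "complex poly poly") (sp3: "complex poly poly")
  (sp4: "complex poly poly") (sp34: "complex poly poly")

instantiation spoly :: ring_1
begin

definition "0 = SPoly 0 0 0 0"
definition "1 = SPoly 1 0 0 0"
definition "p + q = SPoly (sp0 p + sp0 q) (sp3 p + sp3 q) (sp4 p + sp4 q) (sp34 p + sp34 q)"
definition "- p = SPoly (- sp0 p) (- sp3 p) (- sp4 p) (- sp34 p)"
definition "p - q = SPoly (sp0 p - sp0 q) (sp3 p - sp3 q) (sp4 p - sp4 q) (sp34 p - sp34 q)"
definition "p * q = SPoly (sp0 p * sp0 q)
   (sp0 p * sp3 q + sp3 p * sp0 q)
   (sp0 p * sp4 q + sp4 p * sp0 q)
   (sp0 p * sp34 q + sp34 p * sp0 q + sp3 p * sp4 q - sp4 p * sp3 q)"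

instance
  by standard
    (auto simp: zero_spoly_def one_spoly_def plus_spoly_def uminus_spoly_def minus_spoly_def
      times_spoly_def algebra_simps)

end

lemmas spoly_ops = zero_spoly_def one_spoly_def plus_spoly_def uminus_spoly_def
  minus_spoly_def times_spoly_def

definition sconst :: "complex \<Rightarrow> spoly" where "sconst c = SPoly [:[:c:]:] 0 0 0"

definition z1 :: spoly where "z1 = SPoly [:[:0, 1:]:] 0 0 0"
definition z2 :: spoly where "z2 = SPoly [:0, 1:] 0 0 0"
definition z3 :: spoly where "z3 = SPoly 0 1 0 0"
definition z4 :: spoly where "z4 = SPoly 0 0 1 0"

definition d1 :: "spoly \<Rightarrow> spoly" where
  "d1 p = SPoly (map_poly pderiv (sp0 p)) (map_poly pderiv (sp3 p))
     (map_poly pderiv (sp4 p)) (map_poly pderiv (sp34 p))"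

definition d2 :: "spoly \<Rightarrow> spoly" where
  "d2 p = SPoly (pderiv (sp0 p)) (pderiv (sp3 p)) (pderiv (sp4 p)) (pderiv (sp34 p))"

text \<open>The odd derivatives are the left ones: \<open>\<partial>\<^sub>3 (z\<^sub>3 z\<^sub>4) = z\<^sub>4\<close> and \<open>\<partial>\<^sub>4 (z\<^sub>3 z\<^sub>4) = - z\<^sub>3\<close>.\<close>

definition d3 :: "spoly \<Rightarrow> spoly" where "d3 p = SPoly (sp3 p) 0 (sp34 p) 0"
definition d4 :: "spoly \<Rightarrow> spoly" where "d4 p = SPoly (sp4 p) (- sp34 p) 0 0"


section \<open>The polynomial Fock space \<open>F\<close>\<close>

inductive_set gen_ideal :: "'a::ring_1 set \<Rightarrow> 'a set" for S where
  zero: "0 \<in> gen_ideal S"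
| gen: "s \<in> S \<Longrightarrow> a * s * b \<in> gen_ideal S"
| add: "x \<in> gen_ideal S \<Longrightarrow> y \<in> gen_ideal S \<Longrightarrow> x + y \<in> gen_ideal S"

definition fock_ideal :: "spoly set" where
  "fock_ideal = gen_ideal {sconst 2 * z1 * z2 + z3 * z4, z2 * z2, z2 * z3, z2 * z4}"

text \<open>
  Formal series in normal form: \<open>FSeries a b c d\<close> stands for \<open>a + b z\<^sub>2 + c z\<^sub>3 + d z\<^sub>4\<close> with
  power series \<open>a, b, c, d\<close> in \<open>z\<^sub>1\<close>.  They are multiplied modulo the relations of the ideal,
  so \<open>z\<^sub>2\<^sup>2 = z\<^sub>2 z\<^sub>3 = z\<^sub>2 z\<^sub>4 = 0\<close> and \<open>z\<^sub>3 z\<^sub>4 = - 2 z\<^sub>1 z\<^sub>2\<close>; see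
  \<open>nform_mult\<close> and \<open>nform_eq_iff\<close> below.
\<close>

datatype fseries = FSeries (fs1: "complex fps") (fs2: "complex fps")
  (fs3: "complex fps") (fs4: "complex fps")

instantiation fseries :: ring_1
begin

definition "0 = FSeries 0 0 0 0"
definition "1 = FSeries 1 0 0 0"
definition "f + g = FSeries (fs1 f + fs1 g) (fs2 f + fs2 g) (fs3 f + fs3 g) (fs4 f + fs4 g)"
definition "- f = FSeries (- fs1 f) (- fs2 f) (- fs3 f) (- fs4 f)"
definition "f - g = FSeries (fs1 f - fs1 g) (fs2 f - fs2 g) (fs3 f - fs3 g) (fs4 f - fs4 g)"
definition "f * g = FSeries (fs1 f * fs1 g)
   (fs1 f * fs2 g + fs2 f * fs1 g - 2 * fps_X * (fs3 f * fs4 g - fs4 f * fs3 g))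
   (fs1 f * fs3 g + fs3 f * fs1 g)
   (fs1 f * fs4 g + fs4 f * fs1 g)"

instance
  by standard
    (auto simp: zero_fseries_def one_fseries_def plus_fseries_def uminus_fseries_def
      minus_fseries_def times_fseries_def algebra_simps)

end

lemmas fseries_ops = zero_fseries_def one_fseries_def plus_fseries_def uminus_fseries_def
  minus_fseries_def times_fseries_def

definition nform :: "spoly \<Rightarrow> fseries" where
  "nform p = FSeries (fps_of_poly (coeff (sp0 p) 0))
     (fps_of_poly (coeff (sp0 p) 1 - [:0, 2:] * coeff (sp34 p) 0))
     (fps_of_poly (coeff (sp3 p) 0)) (fps_of_poly (coeff (sp4 p) 0))"

lemma coeff_mult_Suc_0:
  "coeff (p * q) (Suc 0) = coeff p 0 * coeff q (Suc 0) + coeff p (Suc 0) * coeff (q::'a::comm_ring_1 poly) 0"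
  by (simp add: coeff_mult)

lemma fps_of_poly_02: "fps_of_poly [:0, 2:] = 2 * (fps_X :: complex fps)"
  by (rule fps_ext) (auto simp: coeff_pCons fps_X_def numeral_fps_const split: nat.splits)

lemma nform_zero: "nform 0 = 0"
  by (simp add: nform_def spoly_ops fseries_ops)

lemma nform_one: "nform 1 = 1"
  by (simp add: nform_def spoly_ops fseries_ops)

lemma nform_add: "nform (p + q) = nform p + nform q"
  by (simp add: nform_def spoly_ops fseries_ops fps_of_poly_add fps_of_poly_diff algebra_simps)

lemma nform_diff: "nform (p - q) = nform p - nform q"
  by (simp add: nform_def spoly_ops fseries_ops fps_of_poly_add fps_of_poly_diff algebra_simps)

lemma nform_mult: "nform (p * q) = nform p * nform q"
  by (simp add: nform_def spoly_ops fseries_ops coeff_mult_0 coeff_mult_Suc_0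
      fps_of_poly_add fps_of_poly_diff fps_of_poly_mult fps_of_poly_02 algebra_simps
      del: mult_pCons_left mult_pCons_right)

lemma nform_eq_0_iff:
  "nform p = 0 \<longleftrightarrow> coeff (sp0 p) 0 = 0 \<and> coeff (sp0 p) 1 = [:0, 2:] * coeff (sp34 p) 0 \<and>
     coeff (sp3 p) 0 = 0 \<and> coeff (sp4 p) 0 = 0"
proof -
  have "fps_of_poly q = 0 \<longleftrightarrow> q = 0" for q :: "complex poly"
    by (simp flip: fps_of_poly_0)
  then show ?thesis
    by (simp add: nform_def fseries_ops del: mult_pCons_left)
qed

lemma fock_ideal_iff: "p \<in> fock_ideal \<longleftrightarrow> nform p = 0"
proof
  assume "p \<in> fock_ideal"
  then show "nform p = 0"
    unfolding fock_ideal_def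
  proof induction
    case zero
    show ?case by (rule nform_zero)
  next
    case (gen s a b)
    have "nform s = 0"
      using gen by (auto simp: nform_eq_0_iff spoly_ops sconst_def z1_def z2_def z3_def z4_def
          coeff_mult_0 coeff_mult_Suc_0)
    then show ?case by (simp add: nform_mult)
  next
    case (add x y)
    then show ?case by (simp add: nform_add)
  qed
next
  assume "nform p = 0"
  then have h: "coeff (sp0 p) 0 = 0" "coeff (sp0 p) 1 = [:0, 2:] * coeff (sp34 p) 0"
     "coeff (sp3 p) 0 = 0" "coeff (sp4 p) 0 = 0"
    by (auto simp: nform_eq_0_iff)
  define sh where "sh q = poly_shift 1 q" for q :: "complex poly poly"
  have sh: "q = [:coeff q 0:] + [:0, 1:] * sh q" for q
    by (rule poly_eqI) (auto simp: sh_def coeff_poly_shift coeff_pCons split: nat.splits)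
  define r where "r = coeff (sp34 p) 0"
  have c1: "coeff (sh (sp0 p)) 0 = [:0, 2:] * r"
    using h(2) by (simp add: sh_def coeff_poly_shift r_def)
  define g1 g2 g3 g4 where
    "g1 = SPoly [:r:] 0 0 0 * (sconst 2 * z1 * z2 + z3 * z4) * 1"
    and "g2 = SPoly (sh (sh (sp0 p))) 0 0 0 * (z2 * z2) * 1"
    and "g3 = SPoly (sh (sp3 p)) 0 0 0 * (z2 * z3) * 1 + SPoly (sh (sp34 p)) 0 0 0 * (z2 * z3) * z4"
    and "g4 = SPoly (sh (sp4 p)) 0 0 0 * (z2 * z4) * 1"
  have "g1 + g2 + g3 + g4 \<in> fock_ideal"
    unfolding fock_ideal_def g1_def g2_def g3_def g4_def
    by (intro gen_ideal.add gen_ideal.gen) auto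
  moreover have "p = g1 + g2 + g3 + g4"
  proof (rule spoly.expand, intro conjI)
    have "sp0 p = [:0, 1:] * ([:[:0, 2:] * r:] + [:0, 1:] * sh (sh (sp0 p)))"
      using sh[of "sp0 p"] sh[of "sh (sp0 p)"] h(1) c1 by (metis add_0 pCons_0_0)
    also have "\<dots> = [:r:] * ([:[:2:]:] * [:[:0, 1:]:] * [:0, 1:]) + sh (sh (sp0 p)) * ([:0, 1:] * [:0, 1:])"
      by (simp add: algebra_simps)
    also have "\<dots> = sp0 (g1 + g2 + g3 + g4)"
      by (simp add: g1_def g2_def g3_def g4_def spoly_ops sconst_def z1_def z2_def z3_def z4_def
          del: mult_pCons_left mult_pCons_right)
    finally show "sp0 p = sp0 (g1 + g2 + g3 + g4)" .
    show "sp3 p = sp3 (g1 + g2 + g3 + g4)"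
      using sh[of "sp3 p"] h(3)
      by (simp add: g1_def g2_def g3_def g4_def spoly_ops sconst_def z1_def z2_def z3_def z4_def)
    show "sp4 p = sp4 (g1 + g2 + g3 + g4)"
      using sh[of "sp4 p"] h(4)
      by (simp add: g1_def g2_def g3_def g4_def spoly_ops sconst_def z1_def z2_def z3_def z4_def)
    show "sp34 p = sp34 (g1 + g2 + g3 + g4)"
      using sh[of "sp34 p"] 
      by (simp add: g1_def g2_def g3_def g4_def spoly_ops sconst_def z1_def z2_def z3_def z4_def r_def)
  qed
  ultimately show "p \<in> fock_ideal" by simp
qed

lemma nform_eq_iff: "nform p = nform q \<longleftrightarrow> p - q \<in> fock_ideal"
  by (simp add: fock_ideal_iff nform_diff)

quotient_type fock_poly = spoly / "\<lambda>p q. p - q \<in> fock_ideal"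
  by (rule equivpI) (auto simp: reflp_def symp_def transp_def simp flip: nform_eq_iff)

lift_definition fock_embed :: "fock_poly \<Rightarrow> fseries" is nform
  by (simp add: nform_eq_iff)


section \<open>The infinitesimal action of the even part\<close>

definition bessel1 :: "real \<Rightarrow> spoly \<Rightarrow> spoly" where
  "bessel1 \<alpha> p = - sconst (of_real \<alpha>) * d1 p + z1 * d1 (d1 p) + z3 * d3 (d1 p) + z4 * d4 (d1 p)
     - sconst (2 * of_real \<alpha>) * z2 * d3 (d4 p)"

definition bessel2 :: "spoly \<Rightarrow> spoly" where
  "bessel2 p = - d2 p + z2 * d2 (d2 p) + z3 * d3 (d2 p) + z4 * d4 (d2 p)
     - sconst 2 * z1 * d3 (d4 p)"

definition euler1 :: "real \<Rightarrow> spoly \<Rightarrow> spoly" where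
  "euler1 \<alpha> p = - sconst (of_real \<alpha>) * p + sconst 2 * z1 * d1 p + z3 * d3 p + z4 * d4 p"

definition euler2 :: "spoly \<Rightarrow> spoly" where
  "euler2 p = - p + sconst 2 * z2 * d2 p + z3 * d3 p + z4 * d4 p"

definition rho_F1 :: "spoly \<Rightarrow> spoly" where "rho_F1 p = sconst 2 * z3 * d4 p"
definition rho_E1 :: "spoly \<Rightarrow> spoly" where "rho_E1 p = sconst (1/2) * z4 * d3 p"
definition rho_H1 :: "spoly \<Rightarrow> spoly" where "rho_H1 p = z4 * d4 p - z3 * d3 p"

definition rho_F2 :: "real \<Rightarrow> spoly \<Rightarrow> spoly" where
  "rho_F2 \<alpha> p = sconst (- \<i>/2) * (z1 * p + bessel1 \<alpha> p) - sconst (\<i>/2) * euler1 \<alpha> p"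
definition rho_E2 :: "real \<Rightarrow> spoly \<Rightarrow> spoly" where
  "rho_E2 \<alpha> p = sconst (- \<i>/2) * (z1 * p + bessel1 \<alpha> p) + sconst (\<i>/2) * euler1 \<alpha> p"
definition rho_H2 :: "real \<Rightarrow> spoly \<Rightarrow> spoly" where "rho_H2 \<alpha> p = z1 * p - bessel1 \<alpha> p"

definition rho_F3 :: "spoly \<Rightarrow> spoly" where
  "rho_F3 p = sconst (- \<i>/2) * (z2 * p + bessel2 p) - sconst (\<i>/2) * euler2 p"
definition rho_E3 :: "spoly \<Rightarrow> spoly" where
  "rho_E3 p = sconst (- \<i>/2) * (z2 * p + bessel2 p) + sconst (\<i>/2) * euler2 p"
definition rho_H3 :: "spoly \<Rightarrow> spoly" where "rho_H3 p = z2 * p - bessel2 p"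

type_synonym mat2 = "real^2^2"

definition sl_E :: mat2 where "sl_E = vector [vector [0, 1], vector [0, 0]]"
definition sl_F :: mat2 where "sl_F = vector [vector [0, 0], vector [1, 0]]"
definition sl_H :: mat2 where "sl_H = vector [vector [1, 0], vector [0, -1]]"

definition even_part :: "(mat2 \<times> mat2 \<times> mat2) set" where
  "even_part = {X. trace X = 0} \<times> {X. trace X = 0} \<times> {X. trace X = 0}"

text \<open>A traceless \<open>X\<close> equals \<open>X\<^sub>1\<^sub>2 E + X\<^sub>2\<^sub>1 F + X\<^sub>1\<^sub>1 H\<close>.\<close>

definition drho_rep :: "real \<Rightarrow> mat2 \<times> mat2 \<times> mat2 \<Rightarrow> spoly \<Rightarrow> spoly" where
  "drho_rep \<alpha> = (\<lambda>(X, Y, Z) p.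
     sconst (of_real (X$1$2)) * rho_E1 p + sconst (of_real (X$2$1)) * rho_F1 p
       + sconst (of_real (X$1$1)) * rho_H1 p
     + sconst (of_real (Y$1$2)) * rho_E2 \<alpha> p + sconst (of_real (Y$2$1)) * rho_F2 \<alpha> p
       + sconst (of_real (Y$1$1)) * rho_H2 \<alpha> p
     + sconst (of_real (Z$1$2)) * rho_E3 p + sconst (of_real (Z$2$1)) * rho_F3 p
       + sconst (of_real (Z$1$1)) * rho_H3 p)"

lemma d_diff:
  "d1 (p - q) = d1 p - d1 q" "d2 (p - q) = d2 p - d2 q"
  "d3 (p - q) = d3 p - d3 q" "d4 (p - q) = d4 p - d4 q"
proof -
  have "map_poly pderiv (a - b) = map_poly pderiv a - map_poly pderiv b" for a b :: "complex poly poly"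
    by (rule poly_eqI) (simp add: coeff_map_poly pderiv_diff)
  then show "d1 (p - q) = d1 p - d1 q" by (simp add: d1_def spoly_ops)
qed (simp_all add: d2_def d3_def d4_def spoly_ops pderiv_diff)

lemma drho_rep_diff: "drho_rep \<alpha> X (p - q) = drho_rep \<alpha> X p - drho_rep \<alpha> X q"
proof -
  have b: "bessel1 \<alpha> (p - q) = bessel1 \<alpha> p - bessel1 \<alpha> q" "bessel2 (p - q) = bessel2 p - bessel2 q"
    "euler1 \<alpha> (p - q) = euler1 \<alpha> p - euler1 \<alpha> q" "euler2 (p - q) = euler2 p - euler2 q"
    by (simp_all add: bessel1_def bessel2_def euler1_def euler2_def d_diff algebra_simps)
  show ?thesis
    by (cases X) (simp add: drho_rep_def rho_E1_def rho_F1_def rho_H1_def rho_E2_def rho_F2_def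
        rho_H2_def rho_E3_def rho_F3_def rho_H3_def b d_diff algebra_simps)
qed

lemma ops_nform_0:
  assumes "nform p = 0"
  shows "nform (rho_E1 p) = 0" "nform (rho_F1 p) = 0" "nform (rho_H1 p) = 0"
    "nform (z1 * p) = 0" "nform (z2 * p) = 0" "nform (bessel1 \<alpha> p) = 0" "nform (bessel2 p) = 0"
    "nform (euler1 \<alpha> p) = 0" "nform (euler2 p) = 0"
proof -
  have h: "coeff (sp0 p) 0 = 0" "coeff (sp0 p) (Suc 0) = [:0, 2:] * coeff (sp34 p) 0"
     "coeff (sp3 p) 0 = 0" "coeff (sp4 p) 0 = 0"
    using assms by (auto simp: nform_eq_0_iff)
  have two: "coeff (2 :: complex poly poly) 0 = [:2:]"
    by (simp add: numeral_poly)
  note s = nform_eq_0_iff spoly_ops sconst_def z1_def z2_def z3_def z4_def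
     d1_def d2_def d3_def d4_def coeff_mult_0 coeff_mult_Suc_0 coeff_map_poly coeff_pderiv
     rho_E1_def rho_F1_def rho_H1_def bessel1_def bessel2_def euler1_def euler2_def h
     pderiv_mult pderiv_pCons pderiv_add pderiv_smult two
  show "nform (rho_E1 p) = 0" "nform (rho_F1 p) = 0" "nform (rho_H1 p) = 0"
    "nform (z1 * p) = 0" "nform (z2 * p) = 0" "nform (bessel2 p) = 0"
    by (simp_all add: s)
  show "nform (bessel1 \<alpha> p) = 0" "nform (euler1 \<alpha> p) = 0" "nform (euler2 p) = 0"
    by (auto simp: s numeral_poly intro!: poly_eqI)
      (auto simp: coeff_pCons coeff_pderiv algebra_simps numeral_poly split: nat.splits)
qed

lemma nform_drho_rep_0: "nform p = 0 \<Longrightarrow> nform (drho_rep \<alpha> X p) = 0"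
  by (cases X) (simp add: drho_rep_def rho_E2_def rho_F2_def
      rho_H2_def rho_E3_def rho_F3_def rho_H3_def nform_mult[of "sconst _"] nform_add nform_diff
      ops_nform_0)

lift_definition drho :: "real \<Rightarrow> mat2 \<times> mat2 \<times> mat2 \<Rightarrow> fock_poly \<Rightarrow> fock_poly" is drho_rep
  by (metis drho_rep_diff fock_ideal_iff nform_drho_rep_0)


section \<open>The Fock space\<close>

text \<open>
  The Hilbert space completion of \<open>F\<close> is realized as the space of all series of finite norm; the
  weights are the squared norms of the orthogonal basis elements
  \<open>z\<^sub>1\<^sup>k, z\<^sub>1\<^sup>k z\<^sub>2, z\<^sub>1\<^sup>k z\<^sub>3, z\<^sub>1\<^sup>k z\<^sub>4\<close>.
\<close>

definition fock_term :: "real \<Rightarrow> fseries \<Rightarrow> fseries \<Rightarrow> nat \<Rightarrow> complex" where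
  "fock_term \<alpha> f g k =
     of_real (fact k * \<bar>pochhammer (- \<alpha>) k\<bar>) *
       (fps_nth (fs1 f) k * cnj (fps_nth (fs1 g) k) + fps_nth (fs2 f) k * cnj (fps_nth (fs2 g) k)) +
     of_real (2 * fact k * \<bar>pochhammer (- \<alpha>) (Suc k)\<bar>) *
       (fps_nth (fs3 f) k * cnj (fps_nth (fs3 g) k) + fps_nth (fs4 f) k * cnj (fps_nth (fs4 g) k))"

definition fock_inner :: "real \<Rightarrow> fseries \<Rightarrow> fseries \<Rightarrow> complex" where
  "fock_inner \<alpha> f g = (\<Sum>k. fock_term \<alpha> f g k)"

definition fock_space :: "real \<Rightarrow> fseries set" where
  "fock_space \<alpha> = {f. summable (fock_term \<alpha> f f)}"

definition fock_norm :: "real \<Rightarrow> fseries \<Rightarrow> real" where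
  "fock_norm \<alpha> f = sqrt (Re (fock_inner \<alpha> f f))"

text \<open>
  \<open>fsubst f w\<^sub>1 w\<^sub>2 w\<^sub>3 w\<^sub>4\<close> is \<open>f(w\<^sub>1, w\<^sub>2, w\<^sub>3, w\<^sub>4)\<close>, substituted in the normal form of \<open>f\<close> and read
  modulo the relations; \<open>w\<^sub>1\<close> is a power series in \<open>z\<^sub>1\<close> without constant term.
\<close>

definition fsubst :: "fseries \<Rightarrow> complex fps \<Rightarrow> spoly \<Rightarrow> spoly \<Rightarrow> spoly \<Rightarrow> fseries" where
  "fsubst f w1 w2 w3 w4 =
     FSeries (fps_compose (fs1 f) w1) 0 0 0 +
     FSeries (fps_compose (fs2 f) w1) 0 0 0 * nform w2 +
     FSeries (fps_compose (fs3 f) w1) 0 0 0 * nform w3 +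
     FSeries (fps_compose (fs4 f) w1) 0 0 0 * nform w4"


section \<open>Exponentials of unbounded operators\<close>

definition fock_bounded_operator :: "real \<Rightarrow> (fseries \<Rightarrow> fseries) \<Rightarrow> bool" where
  "fock_bounded_operator \<alpha> T \<longleftrightarrow>
     (\<forall>f\<in>fock_space \<alpha>. T f \<in> fock_space \<alpha>) \<and>
     (\<forall>f\<in>fock_space \<alpha>. \<forall>g\<in>fock_space \<alpha>. T (f + g) = T f + T g) \<and>
     (\<forall>c. \<forall>f\<in>fock_space \<alpha>. T (nform (sconst c) * f) = nform (sconst c) * T f) \<and>
     (\<exists>C. \<forall>f\<in>fock_space \<alpha>. fock_norm \<alpha> (T f) \<le> C * fock_norm \<alpha> f)"

text \<open>
  The operators \<open>d\<rho>(X)\<close> are in general unbounded with domain \<open>F\<close>, and the exponential series need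
  not converge.  As usual, \<open>exp A\<close> is the time-one map of the strongly continuous one-parameter
  group of bounded operators on the Fock space whose generator extends \<open>A\<close>.
\<close>

definition one_parameter_group :: "real \<Rightarrow> (fock_poly \<Rightarrow> fock_poly) \<Rightarrow> (real \<Rightarrow> fseries \<Rightarrow> fseries) \<Rightarrow> bool"
  where
  "one_parameter_group \<alpha> A U \<longleftrightarrow>
     (\<forall>t. fock_bounded_operator \<alpha> (U t)) \<and>
     (\<forall>f\<in>fock_space \<alpha>. U 0 f = f) \<and>
     (\<forall>s t. \<forall>f\<in>fock_space \<alpha>. U (s + t) f = U s (U t f)) \<and>
     (\<forall>f\<in>fock_space \<alpha>. ((\<lambda>t. fock_norm \<alpha> (U t f - f)) \<longlongrightarrow> 0) (at 0)) \<and>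
     (\<forall>p. ((\<lambda>t. fock_norm \<alpha> (nform (sconst (of_real (1 / t))) * (U t (fock_embed p) - fock_embed p)
              - fock_embed (A p))) \<longlongrightarrow> 0) (at 0))"

definition fock_exp :: "real \<Rightarrow> (fock_poly \<Rightarrow> fock_poly) \<Rightarrow> fseries \<Rightarrow> fseries" where
  "fock_exp \<alpha> A f = (THE g. \<exists>U. one_parameter_group \<alpha> A U \<and> U 1 f = g)"


section \<open>The group \<open>G\<^sub>0\<close> and its representation\<close>

text \<open>\<open>exp\<close> and \<open>(*)\<close> on \<^typ>\<open>real^2^2\<close> would not be the matrix operations.\<close>

definition mat_exp :: "mat2 \<Rightarrow> mat2" where
  "mat_exp X = (\<Sum>n. (1 / fact n) *\<^sub>R (((\<lambda>B. X ** B) ^^ n) (mat 1)))"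

definition G0 :: "(mat2 \<times> mat2 \<times> mat2) set" where
  "G0 = {A. det A = 1} \<times> {A. det A = 1} \<times> {A. det A = 1}"

definition G0_one :: "mat2 \<times> mat2 \<times> mat2" where
  "G0_one = (mat 1, mat 1, mat 1)"

definition G0_mult :: "mat2 \<times> mat2 \<times> mat2 \<Rightarrow> mat2 \<times> mat2 \<times> mat2 \<Rightarrow> mat2 \<times> mat2 \<times> mat2" where
  "G0_mult = (\<lambda>(A, B, C) (A', B', C'). (A ** A', B ** B', C ** C'))"

definition G0_exp :: "mat2 \<times> mat2 \<times> mat2 \<Rightarrow> mat2 \<times> mat2 \<times> mat2" where
  "G0_exp = (\<lambda>(X, Y, Z). (mat_exp X, mat_exp Y, mat_exp Z))"

definition rotation_mat :: "real \<Rightarrow> mat2" where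
  "rotation_mat k = vector [vector [cos k, - sin k], vector [sin k, cos k]]"

definition diagonal_mat :: "real \<Rightarrow> mat2" where
  "diagonal_mat a = vector [vector [exp a, 0], vector [0, exp (- a)]]"

definition K1 where "K1 k = (rotation_mat k, mat 1 :: mat2, mat 1 :: mat2)"
definition K2 where "K2 k = (mat 1 :: mat2, rotation_mat k, mat 1 :: mat2)"
definition K3 where "K3 k = (mat 1 :: mat2, mat 1 :: mat2, rotation_mat k)"
definition A1 where "A1 a = (diagonal_mat a, mat 1 :: mat2, mat 1 :: mat2)"
definition A3 where "A3 a = (mat 1 :: mat2, mat 1 :: mat2, diagonal_mat a)"

text \<open>
  The rule \<open>\<rho>\<^sub>0(exp X) = exp(d\<rho>(X))\<close>.  For \<open>\<alpha> \<notin> \<int>\<close> the right-hand side depends on \<open>X\<close> and not only on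
  the matrices \<open>exp X\<close> (\<open>exp(d\<rho>(2\<pi>(F\<^sub>2 - E\<^sub>2)))\<close> is multiplication by \<open>exp(2\<pi>\<i>\<alpha>)\<close>), that is,
  \<open>\<rho>\<^sub>0\<close> lives on a covering group of \<open>G\<^sub>0\<close>.  Therefore \<open>\<rho>\<^sub>0(exp X)\<close> is a function \<open>rho0_exp\<close> of \<open>X\<close>,
  and \<open>is_rho0 \<alpha> \<rho>\<close> states that it descends to a representation \<open>\<rho>\<close> of the matrix group.
\<close>

definition rho0_exp :: "real \<Rightarrow> mat2 \<times> mat2 \<times> mat2 \<Rightarrow> fseries \<Rightarrow> fseries" where
  "rho0_exp \<alpha> X f = fock_exp \<alpha> (drho \<alpha> X) f"

definition is_rho0 :: "real \<Rightarrow> (mat2 \<times> mat2 \<times> mat2 \<Rightarrow> fseries \<Rightarrow> fseries) \<Rightarrow> bool" where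
  "is_rho0 \<alpha> \<rho> \<longleftrightarrow>
     (\<forall>g\<in>G0. fock_bounded_operator \<alpha> (\<rho> g)) \<and>
     (\<forall>f\<in>fock_space \<alpha>. \<rho> G0_one f = f) \<and>
     (\<forall>g\<in>G0. \<forall>h\<in>G0. \<forall>f\<in>fock_space \<alpha>. \<rho> (G0_mult g h) f = \<rho> g (\<rho> h f)) \<and>
     (\<forall>X\<in>even_part. \<forall>f\<in>fock_space \<alpha>. \<rho> (G0_exp X) f = rho0_exp \<alpha> X f)"

end

theory Submission
  imports Defs
begin

text \<open>\<open>fock_exp\<close> is a definite description, so a formula for it needs existence
  and uniqueness together, and uniqueness has to hold against every strongly continuous group whose
  generator extends the operator on F. Bounding only the real parts of the eigenvalues is essential,
  since the operators may be unbounded: for the rotation in V_2 the eigenvalues grow with k, but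
  along the imaginary axis, so their exponentials stay bounded. Blocks of size 4 arise because the
  terms z_1 + B(z_1), which shift the power of z_1, cancel in F_2 - E_2, while the other four
  generators keep this power in the normal form; \<open>rho_H2\<close> retains both shifts and is
  not of this kind. The base changes are bounded because they mix only basis elements of the same
  parity, which have equal norms for each k. The condition that \<alpha> is not a natural number
  makes all weights positive, hence every coefficient a continuous functional, and this reduces
  uniqueness on eigenvectors to a scalar differential equation.\<close>

text \<open>
  On the coefficients of \<open>z\<^sub>1\<^sup>k, z\<^sub>1\<^sup>k z\<^sub>2, z\<^sub>1\<^sup>k z\<^sub>3, z\<^sub>1\<^sup>k z\<^sub>4\<close> each of the five generators acts by a
  diagonalizable \<open>4 \<times> 4\<close> block for every \<open>k\<close>, with a base change that does not depend on \<open>k\<close> and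
  eigenvalues whose real parts are bounded in \<open>k\<close>. Exponentiating the eigenvalues gives a strongly
  continuous group whose generator extends the operator. It is the only one: any such group multiplies
  an eigenvector by the exponential of its eigenvalue, the eigenvectors span \<open>F\<close>, and \<open>F\<close> is dense.
\<close>

section \<open>The Fock space as a weighted sequence space\<close>

text \<open>The index set is \<open>4\<close>, with \<open>1, 2, 3, 4\<close> standing for \<open>z\<^sub>1\<^sup>k, z\<^sub>1\<^sup>k z\<^sub>2, z\<^sub>1\<^sup>k z\<^sub>3, z\<^sub>1\<^sup>k z\<^sub>4\<close>.\<close>

definition fcoef :: "fseries \<Rightarrow> 4 \<Rightarrow> nat \<Rightarrow> complex" where
  "fcoef f i k = fps_nth (if i = 1 then fs1 f else if i = 2 then fs2 f
     else if i = 3 then fs3 f else fs4 f) k"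

definition of_fcoef :: "(4 \<Rightarrow> nat \<Rightarrow> complex) \<Rightarrow> fseries" where
  "of_fcoef c = FSeries (Abs_fps (c 1)) (Abs_fps (c 2)) (Abs_fps (c 3)) (Abs_fps (c 4))"

lemma fcoef_simps:
  "fcoef f 1 k = fps_nth (fs1 f) k" "fcoef f 2 k = fps_nth (fs2 f) k"
  "fcoef f 3 k = fps_nth (fs3 f) k" "fcoef f 4 k = fps_nth (fs4 f) k"
  by (simp_all add: fcoef_def)

lemma fcoef_of_fcoef [simp]: "fcoef (of_fcoef c) i k = c i k"
  using exhaust_4[of i] by (auto simp: fcoef_simps of_fcoef_def)

lemma fseries_eqI:
  assumes "\<And>i k. fcoef f i k = fcoef g i k"
  shows "f = g"
  using assms[of 1] assms[of 2] assms[of 3] assms[of 4]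
  by (intro fseries.expand conjI fps_ext) (simp_all add: fcoef_simps)

lemma fcoef_add [simp]: "fcoef (f + g) i k = fcoef f i k + fcoef g i k"
  and fcoef_diff [simp]: "fcoef (f - g) i k = fcoef f i k - fcoef g i k"
  and fcoef_zero [simp]: "fcoef 0 i k = 0"
  by (simp_all add: fcoef_def fseries_ops)

lemma nform_sconst: "nform (sconst c) = FSeries (fps_const c) 0 0 0"
  by (simp add: nform_def sconst_def fps_of_poly_const)

abbreviation (input) fscale :: "complex \<Rightarrow> fseries \<Rightarrow> fseries" where
  "fscale c f \<equiv> nform (sconst c) * f"

lemma fcoef_fscale [simp]: "fcoef (fscale c f) i k = c * fcoef f i k"
  by (simp add: nform_sconst fcoef_def fseries_ops)

text \<open>For fixed \<open>k\<close> the weight depends on \<open>i\<close> only through the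
  parity of the basis element. The ratio of the odd to the even weight is 2 |k - \<alpha>|, which is
  unbounded in \<open>k\<close>.\<close>

definition fweight :: "real \<Rightarrow> 4 \<Rightarrow> nat \<Rightarrow> real" where
  "fweight \<alpha> i k = (if i = 1 \<or> i = 2 then fact k * \<bar>pochhammer (- \<alpha>) k\<bar>
     else 2 * fact k * \<bar>pochhammer (- \<alpha>) (Suc k)\<bar>)"

definition fsq :: "real \<Rightarrow> fseries \<Rightarrow> nat \<Rightarrow> real" where
  "fsq \<alpha> f k = (\<Sum>i\<in>UNIV. fweight \<alpha> i k * (cmod (fcoef f i k))\<^sup>2)"

lemma fweight_nonneg: "fweight \<alpha> i k \<ge> 0"
  by (simp add: fweight_def)

text \<open>The factors -\<alpha> + j of the Pochhammer symbol vanish only for natural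
  \<alpha>.\<close>

lemma fweight_pos:
  assumes "\<alpha> \<notin> \<nat>"
  shows "fweight \<alpha> i k > 0"
proof -
  have "pochhammer (- \<alpha>) n \<noteq> 0" for n
    using assms by (auto simp: pochhammer_eq_0_iff)
  then show ?thesis
    by (simp add: fweight_def)
qed

lemma fsq_nonneg: "fsq \<alpha> f k \<ge> 0"
  by (simp add: fsq_def sum_nonneg fweight_nonneg)

lemma fock_term_self: "fock_term \<alpha> f f k = complex_of_real (fsq \<alpha> f k)"
  unfolding fock_term_def fsq_def sum_4 fweight_def fcoef_simps complex_norm_square
    of_real_add of_real_mult
  by (simp add: algebra_simps complex_norm_square flip: of_real_power)

lemma fock_space_iff: "f \<in> fock_space \<alpha> \<longleftrightarrow> summable (fsq \<alpha> f)"
proof -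
  have "fock_term \<alpha> f f = (\<lambda>k. complex_of_real (fsq \<alpha> f k))"
    by (rule ext) (rule fock_term_self)
  then show ?thesis
    by (simp add: fock_space_def summable_of_real_iff)
qed

lemma fock_norm_eq:
  assumes "f \<in> fock_space \<alpha>"
  shows "fock_norm \<alpha> f = sqrt (\<Sum>k. fsq \<alpha> f k)"
  using assms by (simp add: fock_space_iff fock_norm_def fock_inner_def fock_term_self suminf_of_real[symmetric])

lemma fock_norm_nonneg:
  assumes "f \<in> fock_space \<alpha>"
  shows "fock_norm \<alpha> f \<ge> 0"
  using assms by (simp add: fock_norm_eq suminf_nonneg fock_space_iff fsq_nonneg)

text \<open>Operators that preserve the power of z_1 can be compared degree by degree, so a bound on
  each finite block with one common constant is an operator bound.\<close>

lemma fsq_dominated: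
  assumes "f \<in> fock_space \<alpha>" and "\<And>k. fsq \<alpha> g k \<le> C\<^sup>2 * fsq \<alpha> f k" and "C \<ge> 0"
  shows "g \<in> fock_space \<alpha>" and "fock_norm \<alpha> g \<le> C * fock_norm \<alpha> f"
proof -
  have sf: "summable (\<lambda>k. C\<^sup>2 * fsq \<alpha> f k)"
    using assms(1) by (simp add: fock_space_iff summable_mult)
  then show g: "g \<in> fock_space \<alpha>"
    unfolding fock_space_iff
    by (rule summable_comparison_test'[where N = 0]) (simp add: assms fsq_nonneg)
  have "(\<Sum>k. fsq \<alpha> g k) \<le> (\<Sum>k. C\<^sup>2 * fsq \<alpha> f k)"
    using g sf assms(2) by (intro suminf_le) (auto simp: fock_space_iff)
  also have "\<dots> = C\<^sup>2 * (\<Sum>k. fsq \<alpha> f k)"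
    using assms(1) by (simp add: suminf_mult fock_space_iff)
  finally have "sqrt (\<Sum>k. fsq \<alpha> g k) \<le> sqrt (C\<^sup>2 * (\<Sum>k. fsq \<alpha> f k))"
    by (rule real_sqrt_le_mono)
  then show "fock_norm \<alpha> g \<le> C * fock_norm \<alpha> f"
    using g assms by (simp add: fock_norm_eq real_sqrt_mult)
qed

lemma fsq_fscale: "fsq \<alpha> (fscale c f) k = (cmod c)\<^sup>2 * fsq \<alpha> f k"
  by (simp add: fsq_def norm_mult power_mult_distrib sum_distrib_left algebra_simps)

lemma fsq_add_le: "fsq \<alpha> (f + g) k \<le> 2 * fsq \<alpha> f k + 2 * fsq \<alpha> g k"
  and fsq_diff_le: "fsq \<alpha> (f - g) k \<le> 2 * fsq \<alpha> f k + 2 * fsq \<alpha> g k"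
proof -
  have *: "(cmod z)\<^sup>2 \<le> 2 * (cmod x)\<^sup>2 + 2 * (cmod y)\<^sup>2" if "cmod z \<le> cmod x + cmod y" for x y z
  proof -
    have "(cmod z)\<^sup>2 \<le> (cmod x + cmod y)\<^sup>2"
      using that by (intro power_mono) auto
    also have "\<dots> \<le> 2 * (cmod x)\<^sup>2 + 2 * (cmod y)\<^sup>2"
      using zero_le_power2[of "cmod x - cmod y"] unfolding power2_sum power2_diff by linarith
    finally show ?thesis .
  qed
  have "fweight \<alpha> i k * (cmod z)\<^sup>2 \<le>
      2 * (fweight \<alpha> i k * (cmod x)\<^sup>2) + 2 * (fweight \<alpha> i k * (cmod y)\<^sup>2)"
    if "cmod z \<le> cmod x + cmod y" for x y z i
    using mult_left_mono[OF *[OF that] fweight_nonneg[of \<alpha> i k]] by (simp add: algebra_simps)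
  then show "fsq \<alpha> (f + g) k \<le> 2 * fsq \<alpha> f k + 2 * fsq \<alpha> g k"
    "fsq \<alpha> (f - g) k \<le> 2 * fsq \<alpha> f k + 2 * fsq \<alpha> g k"
    unfolding fsq_def sum_distrib_left sum.distrib[symmetric]
    by (auto intro!: sum_mono simp: norm_triangle_ineq norm_triangle_ineq4)
qed

lemma
  assumes "f \<in> fock_space \<alpha>"
  shows fock_space_fscale: "fscale c f \<in> fock_space \<alpha>"
    and fock_space_add: "g \<in> fock_space \<alpha> \<Longrightarrow> f + g \<in> fock_space \<alpha>"
    and fock_space_diff: "g \<in> fock_space \<alpha> \<Longrightarrow> f - g \<in> fock_space \<alpha>"
proof -
  show "fscale c f \<in> fock_space \<alpha>"
    using assms by (simp add: fock_space_iff fsq_fscale[abs_def] summable_mult)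
  assume g: "g \<in> fock_space \<alpha>"
  have s: "summable (\<lambda>k. 2 * fsq \<alpha> f k + 2 * fsq \<alpha> g k)"
    using assms g by (intro summable_add summable_mult) (auto simp: fock_space_iff)
  show "f + g \<in> fock_space \<alpha>" "f - g \<in> fock_space \<alpha>"
    unfolding fock_space_iff
    by (rule summable_comparison_test'[OF s, where N = 0], simp add: fsq_nonneg fsq_add_le fsq_diff_le)+
qed

text \<open>Coefficients are continuous functionals, since a single term of a convergent nonnegative
  series is at most its sum. Norm limits are turned into limits of complex numbers through this
  estimate.\<close>

lemma fcoef_le_fock_norm:
  assumes "\<alpha> \<notin> \<nat>" and "f \<in> fock_space \<alpha>"
  shows "cmod (fcoef f i k) \<le> fock_norm \<alpha> f / sqrt (fweight \<alpha> i k)"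
proof -
  have "fweight \<alpha> i k * (cmod (fcoef f i k))\<^sup>2 \<le> fsq \<alpha> f k"
    unfolding fsq_def by (rule member_le_sum) (auto simp: fweight_nonneg)
  also have "\<dots> \<le> (\<Sum>k. fsq \<alpha> f k)"
    using sum_le_suminf[of "fsq \<alpha> f" "{k}"] assms by (simp add: fock_space_iff fsq_nonneg)
  finally have "sqrt (fweight \<alpha> i k * (cmod (fcoef f i k))\<^sup>2) \<le> fock_norm \<alpha> f"
    using assms by (simp add: fock_norm_eq)
  then show ?thesis
    using fweight_pos[OF assms(1), of i k] by (simp add: real_sqrt_mult field_simps)
qed

section \<open>Truncation in the power of z_1 and density of F\<close>

definition ftrunc :: "nat \<Rightarrow> fseries \<Rightarrow> fseries" where
  "ftrunc n f = of_fcoef (\<lambda>i k. if k < n then fcoef f i k else 0)"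

lemma fcoef_ftrunc [simp]: "fcoef (ftrunc n f) i k = (if k < n then fcoef f i k else 0)"
  by (simp add: ftrunc_def)

lemma fock_space_finite:
  assumes "\<And>i k. k \<ge> n \<Longrightarrow> fcoef f i k = 0"
  shows "f \<in> fock_space \<alpha>"
  unfolding fock_space_iff
  by (rule summable_finite[of "{..<n}"]) (auto simp: fsq_def assms not_less)

lemma ftrunc_tendsto:
  assumes "f \<in> fock_space \<alpha>"
  shows "(\<lambda>n. fock_norm \<alpha> (ftrunc n f - f)) \<longlonglongrightarrow> 0"
proof -
  have mem: "ftrunc n f - f \<in> fock_space \<alpha>" for n
    by (intro fock_space_diff[OF fock_space_finite[of n] assms]) auto
  have sf: "summable (fsq \<alpha> f)"
    using assms by (simp add: fock_space_iff)
  have "(\<Sum>k. fsq \<alpha> (ftrunc n f - f) k) = (\<Sum>k. fsq \<alpha> f (k + n))" for n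
  proof -
    have "(\<Sum>k. fsq \<alpha> (ftrunc n f - f) k)
        = (\<Sum>k. fsq \<alpha> (ftrunc n f - f) (k + n)) + (\<Sum>k<n. fsq \<alpha> (ftrunc n f - f) k)"
      using mem[of n] by (intro suminf_split_initial_segment) (simp add: fock_space_iff)
    then show ?thesis
      by (simp add: fsq_def)
  qed
  moreover have "(\<lambda>n. \<Sum>k. fsq \<alpha> f (k + n)) \<longlonglongrightarrow> 0"
    using sf by (rule suminf_exist_split2)
  ultimately have "(\<lambda>n. sqrt (\<Sum>k. fsq \<alpha> (ftrunc n f - f) k)) \<longlonglongrightarrow> sqrt 0"
    by (intro tendsto_real_sqrt) simp
  then show ?thesis
    using mem by (simp add: fock_norm_eq)
qed

text \<open>The correction in the second line comes from rewriting z_3 z_4 as - 2 z_1 z_2.\<close>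

lemma fcoef_nform:
  "fcoef (nform p) 1 k = coeff (coeff (sp0 p) 0) k"
  "fcoef (nform p) 2 k = coeff (coeff (sp0 p) 1) k - coeff ([:0, 2:] * coeff (sp34 p) 0) k"
  "fcoef (nform p) 3 k = coeff (coeff (sp3 p) 0) k"
  "fcoef (nform p) 4 k = coeff (coeff (sp4 p) 0) k"
  by (simp_all add: fcoef_simps nform_def del: mult_pCons_left)

text \<open>Finite support of the elements of F makes the difference quotients of a group converge
  in norm on them even when the eigenvalues are unbounded in \<open>k\<close>.\<close>

lemma fock_embed_finite:
  obtains n where "\<And>i k. k \<ge> n \<Longrightarrow> fcoef (fock_embed p) i k = 0"
proof -
  have "\<exists>n. \<forall>i k. k \<ge> n \<longrightarrow> fcoef (fock_embed p) i k = 0"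
  proof transfer
    fix p :: spoly
    have "\<exists>n. \<forall>k\<ge>n. coeff q k = 0" for q :: "complex poly"
      by (auto intro!: exI[of _ "Suc (degree q)"] coeff_eq_0)
    then have "\<forall>i. \<exists>n. \<forall>k\<ge>n. fcoef (nform p) i k = 0"
      unfolding forall_4 fcoef_nform coeff_diff[symmetric] by blast
    then obtain n where "\<And>i k. k \<ge> n i \<Longrightarrow> fcoef (nform p) i k = 0"
      by metis
    then have "fcoef (nform p) i k = 0" if "k \<ge> Max (range n)" for i k
      using that Max_ge[of "range n" "n i"] by (meson finite finite_imageI order_trans rangeI)
    then show "\<exists>n. \<forall>i k. k \<ge> n \<longrightarrow> fcoef (nform p) i k = 0"
      by blast
  qed
  then show thesis
    using that by blast
qed

lemma ftrunc_in_range: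
  obtains p where "fock_embed p = ftrunc n f"
proof -
  define c where "c i = (\<Sum>k<n. monom (fcoef f i k) k)" for i
  have c: "coeff (c i) k = (if k < n then fcoef f i k else 0)" for i k
    by (simp add: c_def coeff_sum sum.delta)
  \<comment> \<open>The outer variable is z_2, so this is c_1 + c_2 z_2 + c_3 z_3 + c_4 z_4; without
    a z_3 z_4 term it is already in normal form.\<close>
  have "nform (SPoly [:c 1, c 2:] [:c 3:] [:c 4:] 0) = ftrunc n f" (is "nform ?p = _")
  proof (rule fseries_eqI)
    fix i k
    show "fcoef (nform ?p) i k = fcoef (ftrunc n f) i k"
      using exhaust_4[of i] by (auto simp: fcoef_nform c)
  qed
  then have "fock_embed (abs_fock_poly ?p) = ftrunc n f"
    by (simp add: fock_embed.abs_eq)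
  then show thesis
    using that by blast
qed

lemma fock_embed_in_fock_space: "fock_embed p \<in> fock_space \<alpha>"
  by (rule fock_embed_finite[of p]) (blast intro: fock_space_finite)

section \<open>One-parameter groups with a diagonalizable generator\<close>

definition diag_op :: "(4 \<Rightarrow> nat \<Rightarrow> complex) \<Rightarrow> fseries \<Rightarrow> fseries" where
  "diag_op \<mu> f = of_fcoef (\<lambda>i k. \<mu> i k * fcoef f i k)"

definition mix_op :: "(4 \<Rightarrow> 4 \<Rightarrow> complex) \<Rightarrow> fseries \<Rightarrow> fseries" where
  "mix_op m f = of_fcoef (\<lambda>i k. \<Sum>j\<in>UNIV. m i j * fcoef f j k)"

lemma fcoef_diag_op [simp]: "fcoef (diag_op \<mu> f) i k = \<mu> i k * fcoef f i k"
  by (simp add: diag_op_def)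

lemma fcoef_mix_op [simp]: "fcoef (mix_op m f) i k = (\<Sum>j\<in>UNIV. m i j * fcoef f j k)"
  by (simp add: mix_op_def)

lemma mix_op_linear:
  "mix_op m (f + g) = mix_op m f + mix_op m g"
  "mix_op m (f - g) = mix_op m f - mix_op m g"
  "mix_op m (fscale c f) = fscale c (mix_op m f)"
  by (rule fseries_eqI, simp add: sum.distrib sum_subtractf sum_distrib_left algebra_simps)+

lemma diag_op_linear:
  "diag_op \<mu> (f + g) = diag_op \<mu> f + diag_op \<mu> g"
  "diag_op \<mu> (fscale c f) = fscale c (diag_op \<mu> f)"
  by (rule fseries_eqI, simp add: algebra_simps)+

lemma mix_op_ftrunc: "mix_op m (ftrunc n f) = ftrunc n (mix_op m f)"
  and diag_op_ftrunc: "diag_op \<mu> (ftrunc n f) = ftrunc n (diag_op \<mu> f)"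
  by (rule fseries_eqI, simp)+

text \<open>The bound is the Frobenius norm of \<open>m\<close>, which serves every \<open>k\<close>
  because a nonzero entry of \<open>m\<close> connects only indices with the same weight.\<close>

lemma mix_op_bounded:
  assumes "\<And>i j. m i j \<noteq> 0 \<Longrightarrow> i \<in> {1, 2} \<longleftrightarrow> j \<in> {1, 2}"
  obtains C where "C \<ge> 0"
    and "\<And>\<alpha> f. f \<in> fock_space \<alpha> \<Longrightarrow> mix_op m f \<in> fock_space \<alpha>"
    and "\<And>\<alpha> f. f \<in> fock_space \<alpha> \<Longrightarrow> fock_norm \<alpha> (mix_op m f) \<le> C * fock_norm \<alpha> f"
proof -
  define M where "M = (\<Sum>i\<in>UNIV. \<Sum>j\<in>UNIV. (cmod (m i j))\<^sup>2)"
  have M: "M \<ge> 0"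
    by (simp add: M_def sum_nonneg)
  have fsq_le: "fsq \<alpha> (mix_op m f) k \<le> (sqrt M)\<^sup>2 * fsq \<alpha> f k" for \<alpha> f k
  proof -
    let ?w = "\<lambda>i. fweight \<alpha> i k"
    have "fsq \<alpha> (mix_op m f) k
        \<le> (\<Sum>i\<in>UNIV. (\<Sum>j\<in>UNIV. (cmod (m i j))\<^sup>2) * fsq \<alpha> f k)"
      unfolding fsq_def[of \<alpha> "mix_op m f"]
    proof (rule sum_mono)
      fix i :: 4
      \<comment> \<open>The factor \<open>of_bool (m i j \<noteq> 0)\<close> is harmless here but
        survives Cauchy-Schwarz, where it discards the coefficients whose weight differs from that
        of index \<open>i\<close>.\<close>
      have "cmod (fcoef (mix_op m f) i k)
          \<le> (\<Sum>j\<in>UNIV. cmod (m i j) * cmod (fcoef f j k * of_bool (m i j \<noteq> 0)))"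
        by (auto simp: norm_mult intro!: order_trans[OF norm_sum] sum_mono)
      then have "(cmod (fcoef (mix_op m f) i k))\<^sup>2
          \<le> (\<Sum>j\<in>UNIV. cmod (m i j) * cmod (fcoef f j k * of_bool (m i j \<noteq> 0)))\<^sup>2"
        by (rule power_mono) simp
      also have "\<dots> \<le> (\<Sum>j\<in>UNIV. (cmod (m i j))\<^sup>2)
          * (\<Sum>j\<in>UNIV. (cmod (fcoef f j k * of_bool (m i j \<noteq> 0)))\<^sup>2)"
        by (rule Cauchy_Schwarz_ineq_sum)
      finally have "?w i * (cmod (fcoef (mix_op m f) i k))\<^sup>2
          \<le> ?w i * ((\<Sum>j\<in>UNIV. (cmod (m i j))\<^sup>2)
          * (\<Sum>j\<in>UNIV. (cmod (fcoef f j k * of_bool (m i j \<noteq> 0)))\<^sup>2))"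
        by (rule mult_left_mono[OF _ fweight_nonneg])
      also have "\<dots> = (\<Sum>j\<in>UNIV. (cmod (m i j))\<^sup>2)
          * (\<Sum>j\<in>UNIV. ?w i * (cmod (fcoef f j k * of_bool (m i j \<noteq> 0)))\<^sup>2)"
        by (simp only: sum_distrib_left mult.left_commute)
      also have "\<dots> \<le> (\<Sum>j\<in>UNIV. (cmod (m i j))\<^sup>2) * fsq \<alpha> f k"
        unfolding fsq_def
      proof (intro mult_left_mono sum_mono sum_nonneg)
        fix j
        show "?w i * (cmod (fcoef f j k * of_bool (m i j \<noteq> 0)))\<^sup>2 \<le> ?w j * (cmod (fcoef f j k))\<^sup>2"
          using assms[of i j] by (cases "m i j = 0") (auto simp: fweight_nonneg fweight_def)
      qed simp
      finally show "?w i * (cmod (fcoef (mix_op m f) i k))\<^sup>2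
          \<le> (\<Sum>j\<in>UNIV. (cmod (m i j))\<^sup>2) * fsq \<alpha> f k" .
    qed
    also have "\<dots> = (sqrt M)\<^sup>2 * fsq \<alpha> f k"
      using M by (simp add: M_def sum_distrib_right)
    finally show ?thesis .
  qed
  show thesis
    using fsq_dominated[OF _ fsq_le, of _ \<alpha> for \<alpha>] M by (intro that[of "sqrt M"]) auto
qed

lemma diag_op_bounded:
  assumes "\<And>i k. cmod (\<mu> i k) \<le> C" and "f \<in> fock_space \<alpha>"
  shows "diag_op \<mu> f \<in> fock_space \<alpha>" and "fock_norm \<alpha> (diag_op \<mu> f) \<le> C * fock_norm \<alpha> f"
proof -
  have C: "C \<ge> 0"
    using assms(1) norm_ge_zero order_trans by blast
  have "fsq \<alpha> (diag_op \<mu> f) k \<le> C\<^sup>2 * fsq \<alpha> f k" for k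
    unfolding fsq_def sum_distrib_left
  proof (rule sum_mono)
    fix i
    have "(cmod (\<mu> i k))\<^sup>2 \<le> C\<^sup>2"
      using assms(1) by (intro power_mono) auto
    then show "fweight \<alpha> i k * (cmod (fcoef (diag_op \<mu> f) i k))\<^sup>2
        \<le> C\<^sup>2 * (fweight \<alpha> i k * (cmod (fcoef f i k))\<^sup>2)"
      using mult_right_mono[of "(cmod (\<mu> i k))\<^sup>2" "C\<^sup>2" "fweight \<alpha> i k * (cmod (fcoef f i k))\<^sup>2"]
      by (simp add: norm_mult power_mult_distrib fweight_nonneg algebra_simps)
  qed
  from fsq_dominated[OF assms(2) this C]
  show "diag_op \<mu> f \<in> fock_space \<alpha>" "fock_norm \<alpha> (diag_op \<mu> f) \<le> C * fock_norm \<alpha> f"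
    by auto
qed

text \<open>Dominated convergence for series (Tannery): multipliers that tend to 0 for each index
  and are uniformly bounded tend to 0 strongly, though not necessarily in operator norm.\<close>

lemma diag_op_tendsto_0:
  fixes \<nu> :: "real \<Rightarrow> 4 \<Rightarrow> nat \<Rightarrow> complex"
  assumes lim: "\<And>i k. ((\<lambda>t. \<nu> t i k) \<longlongrightarrow> 0) (at 0)"
    and bd: "eventually (\<lambda>t. \<forall>i k. cmod (\<nu> t i k) \<le> C) (at 0)"
    and f: "f \<in> fock_space \<alpha>"
  shows "((\<lambda>t. fock_norm \<alpha> (diag_op (\<nu> t) f)) \<longlongrightarrow> 0) (at 0)"
proof -
  have "((\<lambda>t. \<Sum>k. fsq \<alpha> (diag_op (\<nu> t) f) k) \<longlongrightarrow> (\<Sum>k. 0)) (at 0)"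
  proof (rule conjunct2[OF conjunct2[OF tannerys_theorem]])
    fix k
    have "((\<lambda>t. fsq \<alpha> (diag_op (\<nu> t) f) k)
        \<longlongrightarrow> (\<Sum>i\<in>UNIV. fweight \<alpha> i k * (cmod (0 * fcoef f i k))\<^sup>2)) (at 0)"
      unfolding fsq_def fcoef_diag_op by (intro tendsto_intros lim)
    then show "((\<lambda>t. fsq \<alpha> (diag_op (\<nu> t) f) k) \<longlongrightarrow> 0) (at 0)"
      by simp
  next
    have "eventually (\<lambda>t. \<forall>k. norm (fsq \<alpha> (diag_op (\<nu> t) f) k) \<le> C\<^sup>2 * fsq \<alpha> f k) (at 0)"
      using bd
    proof eventually_elim
      case (elim t)
      show ?case
      proof
        fix k
        have "fweight \<alpha> i k * (cmod (fcoef (diag_op (\<nu> t) f) i k))\<^sup>2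
            \<le> C\<^sup>2 * (fweight \<alpha> i k * (cmod (fcoef f i k))\<^sup>2)" for i
        proof -
          have "(cmod (\<nu> t i k))\<^sup>2 \<le> C\<^sup>2"
            using elim by (intro power_mono) auto
          then show ?thesis
            using mult_right_mono[of "(cmod (\<nu> t i k))\<^sup>2" "C\<^sup>2" "fweight \<alpha> i k * (cmod (fcoef f i k))\<^sup>2"]
            by (simp add: norm_mult power_mult_distrib fweight_nonneg algebra_simps)
        qed
        then show "norm (fsq \<alpha> (diag_op (\<nu> t) f) k) \<le> C\<^sup>2 * fsq \<alpha> f k"
          using fsq_nonneg[of \<alpha> "diag_op (\<nu> t) f" k]
          by (simp add: fsq_def sum_distrib_left sum_mono)
      qed
    qed
    \<comment> \<open>The domination holds for every \<open>k\<close> at once, so the first factor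
      of the product filter carries no condition.\<close>
    from eventually_prodI[OF eventually_True this]
    show "eventually (\<lambda>(k, t). norm (fsq \<alpha> (diag_op (\<nu> t) f) k) \<le> C\<^sup>2 * fsq \<alpha> f k)
        (at_top \<times>\<^sub>F at 0)"
      by (rule eventually_mono) auto
  next
    show "summable (\<lambda>k. C\<^sup>2 * fsq \<alpha> f k)"
      using f by (simp add: fock_space_iff summable_mult)
  qed simp
  then have "((\<lambda>t. sqrt (\<Sum>k. fsq \<alpha> (diag_op (\<nu> t) f) k)) \<longlongrightarrow> sqrt 0) (at 0)"
    by (intro tendsto_real_sqrt) simp
  moreover have "eventually (\<lambda>t. sqrt (\<Sum>k. fsq \<alpha> (diag_op (\<nu> t) f) k)
      = fock_norm \<alpha> (diag_op (\<nu> t) f)) (at 0)"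
    using bd
  proof eventually_elim
    case (elim t)
    then show ?case
      using diag_op_bounded(1)[of "\<nu> t" C f \<alpha>] f by (simp add: fock_norm_eq)
  qed
  ultimately show ?thesis
    by (simp add: tendsto_cong)
qed

section \<open>The scalar differential equation u' = z u\<close>

lemma has_vector_derivative_iff_quotient:
  "(u has_vector_derivative d) (at t) \<longleftrightarrow> ((\<lambda>h. (u (t + h) - u t) /\<^sub>R h - d) \<longlongrightarrow> 0) (at 0)"
proof -
  have "norm ((u (t + h) - u t) /\<^sub>R h - d) = norm (u (t + h) - u t - h *\<^sub>R d) / norm h"
    if "h \<noteq> 0" for h
  proof -
    have "(u (t + h) - u t) /\<^sub>R h - d = (u (t + h) - u t - h *\<^sub>R d) /\<^sub>R h"
      using that by (simp add: algebra_simps)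
    then show ?thesis
      by (simp add: divide_inverse)
  qed
  then have "((\<lambda>h. norm ((u (t + h) - u t) /\<^sub>R h - d)) \<longlongrightarrow> 0) (at 0) \<longleftrightarrow>
      ((\<lambda>h. norm (u (t + h) - u t - h *\<^sub>R d) / norm h) \<longlongrightarrow> 0) (at 0)"
    by (intro tendsto_cong) (auto simp: eventually_at_filter)
  then show ?thesis
    by (simp add: has_vector_derivative_def has_derivative_at bounded_linear_scaleR_left
        tendsto_norm_zero_iff)
qed

lemma exp_has_vector_derivative:
  "((\<lambda>t. exp (of_real t * z)) has_vector_derivative z * exp (of_real t * z)) (at t)" for z :: complex
  using exp_scaleR_has_vector_derivative_left[of z t] by (simp add: scaleR_conv_of_real)

lemma exp_ode_unique:
  fixes u :: "real \<Rightarrow> complex"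
  assumes "\<And>t. (u has_vector_derivative z * u t) (at t)"
  shows "u t = exp (of_real t * z) * u 0"
proof -
  \<comment> \<open>Integrating factor: multiplied by exp(-t z), the solution has derivative zero
    and is constant.\<close>
  have "((\<lambda>t. exp (of_real t * - z) * u t) has_vector_derivative 0) (at t within UNIV)" for t
    using has_vector_derivative_mult[OF exp_has_vector_derivative[of "- z" t] assms[of t]]
    by (simp add: algebra_simps)
  then obtain c where c: "\<And>t. t \<in> UNIV \<Longrightarrow> exp (of_real t * - z) * u t = c"
    by (rule has_vector_derivative_zero_constant[OF convex_UNIV]) blast
  have "exp (of_real t * z) * exp (of_real t * - z) = 1"
    by (simp flip: exp_add)
  moreover have "exp (of_real t * - z) * u t = u 0"
    using trans[OF c[of t] c[of 0, symmetric]] by simp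
  ultimately show ?thesis
    by (metis mult.assoc mult_1)
qed

text \<open>\<open>m\<close> maps diagonal coordinates to coefficients and \<open>m'\<close> is its
  inverse. Only the real parts of \<open>\<mu>\<close> are bounded, so the operator may be unbounded
  while its exponentials are bounded locally uniformly in time.\<close>

locale diagonalized_generator =
  fixes \<alpha> :: real and A :: "fock_poly \<Rightarrow> fock_poly" and \<mu> :: "4 \<Rightarrow> nat \<Rightarrow> complex"
    and m m' :: "4 \<Rightarrow> 4 \<Rightarrow> complex" and B :: real
  assumes alpha: "\<alpha> \<notin> \<nat>"
    and inverse: "(\<Sum>j\<in>UNIV. m i j * m' j l) = of_bool (i = l)"
      "(\<Sum>j\<in>UNIV. m' i j * m j l) = of_bool (i = l)"
    and block: "m i j \<noteq> 0 \<Longrightarrow> i \<in> {1, 2} \<longleftrightarrow> j \<in> {1, 2}"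
      "m' i j \<noteq> 0 \<Longrightarrow> i \<in> {1, 2} \<longleftrightarrow> j \<in> {1, 2}"
    and Re_bound: "\<bar>Re (\<mu> i k)\<bar> \<le> B"
    and generator: "fock_embed (A p) = mix_op m (diag_op \<mu> (mix_op m' (fock_embed p)))"
begin

definition flow :: "real \<Rightarrow> fseries \<Rightarrow> fseries" where
  "flow t f = mix_op m (diag_op (\<lambda>i k. exp (of_real t * \<mu> i k)) (mix_op m' f))"

lemma mix_inverse: "mix_op m (mix_op m' f) = f" "mix_op m' (mix_op m f) = f"
proof -
  have *: "(\<Sum>j\<in>UNIV. a i j * (\<Sum>l\<in>UNIV. b j l * x l)) = x i"
    if "\<And>i l. (\<Sum>j\<in>UNIV. a i j * b j l) = of_bool (i = l)" for a b :: "4 \<Rightarrow> 4 \<Rightarrow> complex" and x i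
  proof -
    have "(\<Sum>j\<in>UNIV. a i j * (\<Sum>l\<in>UNIV. b j l * x l)) = (\<Sum>l\<in>UNIV. (\<Sum>j\<in>UNIV. a i j * b j l) * x l)"
      unfolding sum_distrib_left sum_distrib_right by (subst sum.swap) (simp add: mult.assoc)
    then show ?thesis
      by (simp add: that of_bool_def if_distrib[of "\<lambda>y. y * _"] sum.delta cong: if_cong)
  qed
  show "mix_op m (mix_op m' f) = f" "mix_op m' (mix_op m f) = f"
    by (rule fseries_eqI, simp add: *[OF inverse(1)] *[OF inverse(2)])+
qed

lemma cmod_exp_le: "cmod (exp (of_real t * \<mu> i k)) \<le> exp (\<bar>t\<bar> * B)"
  using mult_left_mono[OF Re_bound[of i k] abs_ge_zero[of t]] by (simp add: abs_mult[symmetric])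

lemma flow_bounded: "fock_bounded_operator \<alpha> (flow t)"
proof -
  obtain C where C: "C \<ge> 0" "\<And>f. f \<in> fock_space \<alpha> \<Longrightarrow> mix_op m f \<in> fock_space \<alpha>"
    "\<And>f. f \<in> fock_space \<alpha> \<Longrightarrow> fock_norm \<alpha> (mix_op m f) \<le> C * fock_norm \<alpha> f"
    using mix_op_bounded[of m] block(1) by metis
  obtain C' where C': "C' \<ge> 0" "\<And>f. f \<in> fock_space \<alpha> \<Longrightarrow> mix_op m' f \<in> fock_space \<alpha>"
    "\<And>f. f \<in> fock_space \<alpha> \<Longrightarrow> fock_norm \<alpha> (mix_op m' f) \<le> C' * fock_norm \<alpha> f"
    using mix_op_bounded[of m'] block(2) by metis
  note d = diag_op_bounded[OF cmod_exp_le[of t]]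
  have "fock_norm \<alpha> (flow t f) \<le> (C * (exp (\<bar>t\<bar> * B) * C')) * fock_norm \<alpha> f"
    if "f \<in> fock_space \<alpha>" for f
  proof -
    have "fock_norm \<alpha> (flow t f) \<le> C * (exp (\<bar>t\<bar> * B) * fock_norm \<alpha> (mix_op m' f))"
      unfolding flow_def using that by (intro order_trans[OF C(3)] mult_left_mono d C C')
    also have "\<dots> \<le> C * (exp (\<bar>t\<bar> * B) * (C' * fock_norm \<alpha> f))"
      using that by (intro mult_left_mono C C') auto
    finally show ?thesis
      by (simp add: mult.assoc)
  qed
  moreover have "flow t f \<in> fock_space \<alpha>" if "f \<in> fock_space \<alpha>" for f
    unfolding flow_def using that by (intro C C' d)
  ultimately show ?thesis
    unfolding fock_bounded_operator_def flow_def by (auto simp: mix_op_linear diag_op_linear)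
qed

lemma mix_tendsto_0:
  assumes "\<And>t. g t \<in> fock_space \<alpha>" and "((\<lambda>t. fock_norm \<alpha> (g t)) \<longlongrightarrow> 0) F"
  shows "((\<lambda>t. fock_norm \<alpha> (mix_op m (g t))) \<longlongrightarrow> 0) F"
proof -
  obtain C where C: "C \<ge> 0" "\<And>f. f \<in> fock_space \<alpha> \<Longrightarrow> mix_op m f \<in> fock_space \<alpha>"
    "\<And>f. f \<in> fock_space \<alpha> \<Longrightarrow> fock_norm \<alpha> (mix_op m f) \<le> C * fock_norm \<alpha> f"
    using mix_op_bounded[of m] block(1) by metis
  have "((\<lambda>t. C * fock_norm \<alpha> (g t)) \<longlongrightarrow> 0) F"
    using tendsto_mult_right_zero[OF assms(2)] .
  then show ?thesis
    by (rule Lim_null_comparison[rotated]) (simp add: C fock_norm_nonneg assms(1))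
qed

lemma flow_group: "one_parameter_group \<alpha> A flow"
  unfolding one_parameter_group_def
proof (intro conjI allI ballI)
  fix t
  show "fock_bounded_operator \<alpha> (flow t)"
    by (rule flow_bounded)
next
  fix f
  have "diag_op (\<lambda>i k. 1) (mix_op m' f) = mix_op m' f"
    by (rule fseries_eqI) simp
  then show "flow 0 f = f"
    by (simp add: flow_def mix_inverse)
next
  fix s t f
  have "diag_op (\<lambda>i k. exp (of_real (s + t) * \<mu> i k)) g
      = diag_op (\<lambda>i k. exp (of_real s * \<mu> i k)) (diag_op (\<lambda>i k. exp (of_real t * \<mu> i k)) g)" for g
    by (rule fseries_eqI) (simp add: distrib_right exp_add)
  then show "flow (s + t) f = flow s (flow t f)"
    by (simp add: flow_def mix_inverse)
next
  fix f assume f: "f \<in> fock_space \<alpha>"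
  define g where "g = mix_op m' f"
  have g: "g \<in> fock_space \<alpha>"
    using mix_op_bounded[of m'] block(2) f unfolding g_def by metis
  define \<nu> where "\<nu> t i k = exp (of_real t * \<mu> i k) - 1" for t i k
  have bd: "cmod (\<nu> t i k) \<le> exp (\<bar>t\<bar> * B) + 1" for t i k
    unfolding \<nu>_def by (intro order_trans[OF norm_triangle_ineq4] add_mono cmod_exp_le) simp
  have B: "B \<ge> 0"
    using Re_bound[of 1 0] by linarith
  have "flow t f - f = mix_op m (diag_op (\<nu> t) g)" for t
  proof -
    have "diag_op (\<nu> t) g = diag_op (\<lambda>i k. exp (of_real t * \<mu> i k)) g - g"
      by (rule fseries_eqI) (simp add: \<nu>_def algebra_simps)
    then show ?thesis
      by (simp add: flow_def g_def mix_op_linear mix_inverse)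
  qed
  moreover have "((\<lambda>t. fock_norm \<alpha> (diag_op (\<nu> t) g)) \<longlongrightarrow> 0) (at 0)"
  proof (rule diag_op_tendsto_0[OF _ _ g])
    show "((\<lambda>t. \<nu> t i k) \<longlongrightarrow> 0) (at 0)" for i k
      unfolding \<nu>_def by (auto intro!: tendsto_eq_intros)
    \<comment> \<open>For |t| < 1 the bound exp(|t| B) + 1 can be replaced by a constant, as
      domination requires.\<close>
    have "eventually (\<lambda>t. t \<in> {-1<..<1::real}) (at 0)"
      by (rule eventually_at_in_open') auto
    then show "eventually (\<lambda>t. \<forall>i k. cmod (\<nu> t i k) \<le> exp B + 1) (at 0)"
    proof eventually_elim
      case (elim t)
      then have "exp (\<bar>t\<bar> * B) \<le> exp B"
        using mult_right_mono[of "\<bar>t\<bar>" 1 B] B by auto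
      then show ?case
        using bd[of t] by (meson add_right_mono order_trans)
    qed
  qed
  ultimately show "((\<lambda>t. fock_norm \<alpha> (flow t f - f)) \<longlongrightarrow> 0) (at 0)"
    using mix_tendsto_0[of "\<lambda>t. diag_op (\<nu> t) g"] diag_op_bounded(1)[OF bd g] by simp
next
  fix p
  define g where "g = mix_op m' (fock_embed p)"
  define \<nu> where "\<nu> t i k = (exp (of_real t * \<mu> i k) - 1) / of_real t - \<mu> i k" for t :: real and i k
  obtain n where "\<And>i k. k \<ge> n \<Longrightarrow> fcoef (fock_embed p) i k = 0"
    by (rule fock_embed_finite[of p]) blast
  then have n: "fcoef g i k = 0" if "k \<ge> n" for i k
    using that by (simp add: g_def)
  \<comment> \<open>The multipliers \<open>\<nu> t\<close> need not be bounded in \<open>k\<close>.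
    Cutting them off at \<open>n\<close> does not change their effect on \<open>g\<close>, and a
    uniform bound then follows from finitely many limits.\<close>
  define \<nu>' where "\<nu>' t i k = (if k < n then \<nu> t i k else 0)" for t i k
  have g: "g \<in> fock_space \<alpha>"
    using n by (rule fock_space_finite)
  have dg: "diag_op (\<nu>' t) g \<in> fock_space \<alpha>" for t
    by (rule fock_space_finite[of n]) (simp add: n)
  have "fscale (of_real (1 / t)) (flow t (fock_embed p) - fock_embed p) - fock_embed (A p)
      = mix_op m (diag_op (\<nu>' t) g)" for t
  proof -
    have "diag_op (\<nu>' t) g
        = fscale (of_real (1 / t)) (diag_op (\<lambda>i k. exp (of_real t * \<mu> i k)) g - g) - diag_op \<mu> g"
      using n by (intro fseries_eqI) (auto simp: \<nu>'_def \<nu>_def diff_divide_distrib algebra_simps not_less)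
    then show ?thesis
      by (simp add: flow_def g_def mix_op_linear mix_inverse generator)
  qed
  moreover have "((\<lambda>t. fock_norm \<alpha> (diag_op (\<nu>' t) g)) \<longlongrightarrow> 0) (at 0)"
  proof (rule diag_op_tendsto_0[OF _ _ g])
    show lim: "((\<lambda>t. \<nu>' t i k) \<longlongrightarrow> 0) (at 0)" for i k
      unfolding \<nu>'_def \<nu>_def using exp_has_vector_derivative[of "\<mu> i k" 0]
      by (cases "k < n")
        (simp_all add: has_vector_derivative_iff_quotient scaleR_conv_of_real divide_inverse mult.commute)
    have "eventually (\<lambda>t. \<forall>i\<in>UNIV. \<forall>k\<in>{..<n}. cmod (\<nu>' t i k) < 1) (at 0)"
      using tendstoD[OF lim, of 1] by (intro eventually_ball_finite ballI) (auto simp: dist_norm)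
    then show "eventually (\<lambda>t. \<forall>i k. cmod (\<nu>' t i k) \<le> 1) (at 0)"
    proof eventually_elim
      case (elim t)
      have "cmod (\<nu>' t i k) \<le> 1" for i k
      proof (cases "k < n")
        case True
        then have "cmod (\<nu>' t i k) < 1"
          using elim by blast
        then show ?thesis
          by (rule less_imp_le)
      qed (simp add: \<nu>'_def)
      then show ?case
        by blast
    qed
  qed
  ultimately show "((\<lambda>t. fock_norm \<alpha> (fscale (of_real (1 / t)) (flow t (fock_embed p) - fock_embed p)
      - fock_embed (A p))) \<longlongrightarrow> 0) (at 0)"
    using mix_tendsto_0[of "\<lambda>t. diag_op (\<nu>' t) g"] dg by simp
qed

text \<open>Column \<open>i\<close> of \<open>m\<close> placed at the power \<open>k\<close> of z_1.
  Its support is finite, so it lies in F, where the generator condition of an arbitrary group can be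
  used.\<close>

definition eigenvector :: "4 \<Rightarrow> nat \<Rightarrow> fseries" where
  "eigenvector i k = mix_op m (of_fcoef (\<lambda>j l. of_bool (j = i \<and> l = k)))"

text \<open>
  Each coefficient of \<open>U t v\<close> solves \<open>u' = \<mu> u\<close>. As the coefficients are continuous functionals, only the
  boundedness of the single operator \<open>U t\<close> enters, not a bound that is uniform in \<open>t\<close>.
\<close>

lemma group_eigenvector:
  assumes U: "one_parameter_group \<alpha> A U"
  shows "U t (eigenvector i k) = fscale (exp (of_real t * \<mu> i k)) (eigenvector i k)"
proof (rule fseries_eqI)
  fix j l
  let ?e = "eigenvector i k"
  have "ftrunc (Suc k) ?e = ?e"
    by (rule fseries_eqI) (auto simp: eigenvector_def)
  then obtain p where p: "fock_embed p = ?e"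
    using ftrunc_in_range by metis
  have e: "?e \<in> fock_space \<alpha>"
    using fock_embed_in_fock_space p by metis
  have A: "fock_embed (A p) = fscale (\<mu> i k) ?e"
    unfolding generator p eigenvector_def mix_inverse mix_op_linear[symmetric]
    by (rule arg_cong[of _ _ "mix_op m"], rule fseries_eqI) auto
  have "((\<lambda>t. fcoef (U t ?e) j l) has_vector_derivative \<mu> i k * fcoef (U t ?e) j l) (at t)" for t
  proof -
    from U have bo: "fock_bounded_operator \<alpha> (U s)" for s
      by (simp add: one_parameter_group_def)
    have mem: "U s f \<in> fock_space \<alpha>" if "f \<in> fock_space \<alpha>" for s f
      using bo[of s] that by (simp add: fock_bounded_operator_def)
    have add: "U t (f + g) = U t f + U t g" if "f \<in> fock_space \<alpha>" "g \<in> fock_space \<alpha>" for f g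
      using bo[of t] that by (simp add: fock_bounded_operator_def)
    have scale: "U t (fscale c f) = fscale c (U t f)" if "f \<in> fock_space \<alpha>" for f c
      using bo[of t] that by (simp add: fock_bounded_operator_def)
    have diff: "U t (f - g) = U t f - U t g" if "f \<in> fock_space \<alpha>" "g \<in> fock_space \<alpha>" for f g
      using add[OF fock_space_diff[OF that] that(2)] by simp
    obtain C where C: "\<And>f. f \<in> fock_space \<alpha> \<Longrightarrow> fock_norm \<alpha> (U t f) \<le> C * fock_norm \<alpha> f"
      using bo[of t] unfolding fock_bounded_operator_def by blast
    \<comment> \<open>The defect of the generator condition at time 0. Applying \<open>U t\<close>
      and the group law turns it into the defect of the differential equation at time
      \<open>t\<close>.\<close>
    define r where "r h = fscale (of_real (1 / h)) (U h ?e - ?e) - fscale (\<mu> i k) ?e" for h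
    have r: "r h \<in> fock_space \<alpha>" for h
      unfolding r_def by (intro fock_space_diff fock_space_fscale mem e)
    have "((\<lambda>h. fock_norm \<alpha> (r h)) \<longlongrightarrow> 0) (at 0)"
      using U unfolding one_parameter_group_def r_def p[symmetric] A[unfolded p[symmetric], symmetric]
      by blast
    then have "((\<lambda>h. C * fock_norm \<alpha> (r h) / sqrt (fweight \<alpha> j l)) \<longlongrightarrow> 0) (at 0)"
      by (intro tendsto_divide_zero tendsto_mult_right_zero)
    moreover have "\<forall>h. cmod (fcoef (U t (r h)) j l) \<le> C * fock_norm \<alpha> (r h) / sqrt (fweight \<alpha> j l)"
      by (intro allI order_trans[OF fcoef_le_fock_norm[OF alpha mem[OF r]]] divide_right_mono C r)
        (simp add: fweight_nonneg)
    ultimately have "((\<lambda>h. fcoef (U t (r h)) j l) \<longlongrightarrow> 0) (at 0)"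
      by (rule Lim_null_comparison[rotated, OF _ always_eventually])
    moreover have "U t (r h) = fscale (of_real (1 / h)) (U (t + h) ?e - U t ?e) - fscale (\<mu> i k) (U t ?e)" for h
    proof -
      have "U (t + h) ?e = U t (U h ?e)"
        using U e by (simp add: one_parameter_group_def)
      then show ?thesis
        unfolding r_def by (simp only: diff scale mem fock_space_diff fock_space_fscale e)
    qed
    ultimately have "((\<lambda>h. (fcoef (U (t + h) ?e) j l - fcoef (U t ?e) j l) /\<^sub>R h - \<mu> i k * fcoef (U t ?e) j l) \<longlongrightarrow> 0) (at 0)"
      by (simp add: scaleR_conv_of_real divide_inverse)
    then show ?thesis
      by (simp add: has_vector_derivative_iff_quotient)
  qed
  then have "fcoef (U t ?e) j l = exp (of_real t * \<mu> i k) * fcoef (U 0 ?e) j l"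
    by (rule exp_ode_unique)
  then show "fcoef (U t ?e) j l = fcoef (fscale (exp (of_real t * \<mu> i k)) ?e) j l"
    using U e by (simp add: one_parameter_group_def)
qed

lemma group_unique:
  assumes U: "one_parameter_group \<alpha> A U" and f: "f \<in> fock_space \<alpha>"
  shows "U t f = flow t f"
proof (rule fseries_eqI)
  fix i k
  from U have bo: "fock_bounded_operator \<alpha> (U t)"
    by (simp add: one_parameter_group_def)
  have mem: "U t f \<in> fock_space \<alpha>" if "f \<in> fock_space \<alpha>" for f
    using bo that by (simp add: fock_bounded_operator_def)
  have add: "U t (f + g) = U t f + U t g" if "f \<in> fock_space \<alpha>" "g \<in> fock_space \<alpha>" for f g
    using bo that by (simp add: fock_bounded_operator_def)
  have scale: "U t (fscale c f) = fscale c (U t f)" if "f \<in> fock_space \<alpha>" for f c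
    using bo that by (simp add: fock_bounded_operator_def)
  have diff: "U t (f - g) = U t f - U t g" if "f \<in> fock_space \<alpha>" "g \<in> fock_space \<alpha>" for f g
    using add[OF fock_space_diff[OF that] that(2)] by simp
  obtain C where C: "\<And>f. f \<in> fock_space \<alpha> \<Longrightarrow> fock_norm \<alpha> (U t f) \<le> C * fock_norm \<alpha> f"
    using bo unfolding fock_bounded_operator_def by blast
  have memt: "ftrunc n g \<in> fock_space \<alpha>" for n g
    by (rule fock_space_finite[of n]) simp
  have meme: "eigenvector j n \<in> fock_space \<alpha>" for j n
    by (rule fock_space_finite[of "Suc n"]) (simp add: eigenvector_def)
  have fl: "flow t (f + g) = flow t f + flow t g" "flow t (fscale c f) = fscale c (flow t f)" for f g c
    by (simp_all add: flow_def mix_op_linear diag_op_linear)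
  \<comment> \<open>Raising the truncation by one adds a combination of the four eigenvectors at the
    power \<open>n\<close>, on which any two such groups agree.\<close>
  have trunc: "U t (ftrunc n f) = flow t (ftrunc n f)" for n
  proof (induction n)
    case 0
    have fscale_0: "fscale 0 g = 0" for g
      by (rule fseries_eqI) simp
    have "ftrunc 0 f = 0"
      by (rule fseries_eqI) simp
    then show ?case
      \<comment> \<open>Homogeneity with the scalar 0 gives the value 0 at 0 for both
        groups.\<close>
      using scale[of 0 0] fl(2)[of 0 0] memt[of 0 f] by (simp add: fscale_0)
  next
    case (Suc n)
    let ?v = "\<lambda>j. fscale (fcoef (mix_op m' f) j n) (eigenvector j n)"
    let ?w = "\<lambda>j. fscale (fcoef (mix_op m' f) j n) (of_fcoef (\<lambda>i l. of_bool (i = j \<and> l = n)))"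
    have "ftrunc (Suc n) (mix_op m' f) = ftrunc n (mix_op m' f) + (?w 1 + ?w 2 + ?w 3 + ?w 4)"
    proof (rule fseries_eqI)
      fix i l
      show "fcoef (ftrunc (Suc n) (mix_op m' f)) i l
          = fcoef (ftrunc n (mix_op m' f) + (?w 1 + ?w 2 + ?w 3 + ?w 4)) i l"
        using exhaust_4[of i] by (auto simp: less_Suc_eq simp del: fcoef_mix_op)
    qed
    then have "mix_op m (ftrunc (Suc n) (mix_op m' f))
        = mix_op m (ftrunc n (mix_op m' f) + (?w 1 + ?w 2 + ?w 3 + ?w 4))"
      by (rule arg_cong)
    then have eq: "ftrunc (Suc n) f = ftrunc n f + (?v 1 + ?v 2 + ?v 3 + ?v 4)"
      by (simp only: mix_op_linear mix_op_ftrunc mix_inverse eigenvector_def)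
    have v: "?v j \<in> fock_space \<alpha>" for j
      by (intro fock_space_fscale meme)
    have "U t (?v j) = flow t (?v j)" for j
      using group_eigenvector[OF U] group_eigenvector[OF flow_group] by (simp add: scale meme fl)
    then show ?case
      unfolding eq by (simp only: add fl(1) Suc.IH v fock_space_add memt)
  qed
  have "(\<lambda>n. C * fock_norm \<alpha> (ftrunc n f - f) / sqrt (fweight \<alpha> i k)) \<longlonglongrightarrow> 0"
    by (intro tendsto_divide_zero tendsto_mult_right_zero ftrunc_tendsto f)
  moreover have "\<forall>n. cmod (fcoef (U t (ftrunc n f - f)) i k)
      \<le> C * fock_norm \<alpha> (ftrunc n f - f) / sqrt (fweight \<alpha> i k)"
    by (intro allI order_trans[OF fcoef_le_fock_norm[OF alpha]] divide_right_mono C mem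
        fock_space_diff memt f) (simp add: fweight_nonneg)
  ultimately have "(\<lambda>n. fcoef (U t (ftrunc n f - f)) i k) \<longlonglongrightarrow> 0"
    by (rule Lim_null_comparison[rotated, OF _ always_eventually])
  then have U_lim: "(\<lambda>n. fcoef (flow t (ftrunc n f)) i k) \<longlonglongrightarrow> fcoef (U t f) i k"
    by (simp add: diff memt f trunc LIM_zero_iff)
  \<comment> \<open>The explicit flow preserves the power of z_1, so its coefficient at
    \<open>k\<close> is already final once \<open>n\<close> exceeds \<open>k\<close>.\<close>
  have "eventually (\<lambda>n. fcoef (flow t (ftrunc n f)) i k = fcoef (flow t f) i k) sequentially"
    using eventually_gt_at_top[of k]
    by eventually_elim (simp add: flow_def mix_op_ftrunc diag_op_ftrunc del: fcoef_mix_op fcoef_diag_op)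
  then have "(\<lambda>n. fcoef (flow t (ftrunc n f)) i k) \<longlonglongrightarrow> fcoef (flow t f) i k"
    by (rule tendsto_eventually)
  with U_lim show "fcoef (U t f) i k = fcoef (flow t f) i k"
    by (rule LIMSEQ_unique)
qed

text \<open>A group is determined only on the Fock space and its values elsewhere are arbitrary; the
  description succeeds because it asks for the value at \<open>f\<close>, not for the group.\<close>

lemma fock_exp_eq:
  assumes "f \<in> fock_space \<alpha>"
  shows "fock_exp \<alpha> A f = mix_op m (diag_op (\<lambda>i k. exp (\<mu> i k)) (mix_op m' f))"
proof -
  have "fock_exp \<alpha> A f = flow 1 f"
    unfolding fock_exp_def 
    by (rule the_equality) (use flow_group group_unique[OF _ assms] in blast)+
  then show ?thesis
    by (simp add: flow_def)
qed

end

section \<open>The generators on coefficients\<close>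

definition id_mix :: "4 \<Rightarrow> 4 \<Rightarrow> complex" where
  "id_mix i j = of_bool (i = j)"

lemma mix_op_id [simp]: "mix_op id_mix f = f"
  by (rule fseries_eqI) (simp add: id_mix_def sum.delta of_bool_def if_distrib[of "\<lambda>y. y * _"] cong: if_cong)

lemma coeff_numeral_2: "coeff (2 :: complex poly poly) 0 = [:2:]"
  by (simp add: numeral_poly)

lemma fcoef_z2_mult:
  "fcoef (nform (z2 * p)) 1 k = 0" "fcoef (nform (z2 * p)) 2 k = fcoef (nform p) 1 k"
  "fcoef (nform (z2 * p)) 3 k = 0" "fcoef (nform (z2 * p)) 4 k = 0"
  by (simp_all add: fcoef_nform z2_def spoly_ops coeff_mult_Suc_0)

text \<open>The term - 2 z_1 d_3 d_4 sends z_3 z_4 to 2 z_1. This agrees with z_3 z_4 = - 2 z_1 z_2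
  and z_2 being sent to -1, so the result depends only on the normal form.\<close>

lemma fcoef_bessel2:
  "fcoef (nform (bessel2 p)) 1 k = - fcoef (nform p) 2 k" "fcoef (nform (bessel2 p)) 2 k = 0"
  "fcoef (nform (bessel2 p)) 3 k = 0" "fcoef (nform (bessel2 p)) 4 k = 0"
  by (simp_all add: fcoef_nform bessel2_def z1_def z2_def z3_def z4_def d2_def d3_def d4_def
      sconst_def spoly_ops coeff_numeral_2 coeff_mult_Suc_0 coeff_mult_0 coeff_pderiv)

text \<open>An Euler operator shifted by -\<alpha>: z_1 has degree 2, z_3 and z_4 have degree 1, z_2
  has degree 0, and the relations are homogeneous for this grading.\<close>

lemma fcoef_euler1:
  "fcoef (nform (euler1 \<alpha> p)) i k
     = (2 * of_nat k - of_real \<alpha> + of_bool (i = 3 \<or> i = 4)) * fcoef (nform p) i k"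
  using exhaust_4[of i]
  by (auto simp: fcoef_nform euler1_def z1_def z2_def z3_def z4_def d1_def d3_def d4_def
      sconst_def spoly_ops coeff_numeral_2 coeff_mult_Suc_0 coeff_mult_0 coeff_pderiv coeff_map_poly coeff_pCons
      algebra_simps split: nat.splits)

text \<open>The same with z_2 of degree 2, z_1 of degree 0 and shift -1; the degrees 0, 2, 1, 1 give
  -1, 1, 0, 0.\<close>

lemma fcoef_euler2:
  "fcoef (nform (euler2 p)) i k
     = (if i = 1 then -1 else if i = 2 then 1 else 0) * fcoef (nform p) i k"
  using exhaust_4[of i]
  by (auto simp: fcoef_nform euler2_def z1_def z2_def z3_def z4_def d2_def d3_def d4_def
      sconst_def spoly_ops coeff_numeral_2 coeff_mult_Suc_0 coeff_mult_0 coeff_pderiv coeff_pCons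
      algebra_simps split: nat.splits)

lemma fcoef_rho1:
  "fcoef (nform (rho_E1 p)) i k = (if i = 4 then fcoef (nform p) 3 k / 2 else 0)"
  "fcoef (nform (rho_F1 p)) i k = (if i = 3 then 2 * fcoef (nform p) 4 k else 0)"
  "fcoef (nform (rho_H1 p)) i k
     = (if i = 3 then - fcoef (nform p) 3 k else if i = 4 then fcoef (nform p) 4 k else 0)"
  using exhaust_4[of i]
  by (auto simp: fcoef_nform rho_E1_def rho_F1_def rho_H1_def z3_def z4_def d3_def d4_def
      sconst_def spoly_ops coeff_numeral_2 coeff_mult_Suc_0 coeff_mult_0 coeff_pCons
      algebra_simps split: nat.splits)

text \<open>Multiplication and the Bessel operator enter E and F with the same sign and cancel in F
  - E, which leaves -i times the Euler operator.\<close>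

lemma fcoef_rho_rot:
  "fcoef (nform (rho_F2 \<alpha> p)) i k - fcoef (nform (rho_E2 \<alpha> p)) i k
     = - \<i> * (2 * of_nat k - of_real \<alpha> + of_bool (i = 3 \<or> i = 4)) * fcoef (nform p) i k"
  "fcoef (nform (rho_F3 p)) i k - fcoef (nform (rho_E3 p)) i k
     = - \<i> * (if i = 1 then -1 else if i = 2 then 1 else 0) * fcoef (nform p) i k"
  by (simp_all add: rho_F2_def rho_E2_def rho_F3_def rho_E3_def nform_add nform_diff
      nform_mult[of "sconst _"] fcoef_euler1 fcoef_euler2 del: of_bool_or_iff)

text \<open>Multiplication by z_2 sends 1 to z_2, and minus the Bessel operator sends z_2 back to
  1.\<close>

lemma fcoef_rho_H3:
  "fcoef (nform (rho_H3 p)) i k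
     = (if i = 1 then fcoef (nform p) 2 k else if i = 2 then fcoef (nform p) 1 k else 0)"
  using exhaust_4[of i] by (auto simp: rho_H3_def nform_diff fcoef_z2_mult fcoef_bessel2)

lemma nform_sconst_0 [simp]: "nform (sconst 0) = 0"
  by (simp add: nform_sconst fseries_ops)

lemma nform_drho_rep_rotation:
  "fcoef (nform (drho_rep \<alpha> (t *\<^sub>R (sl_F - sl_E), 0, 0) p)) i k
     = of_real t * (fcoef (nform (rho_F1 p)) i k - fcoef (nform (rho_E1 p)) i k)"
  "fcoef (nform (drho_rep \<alpha> (0, t *\<^sub>R (sl_F - sl_E), 0) p)) i k
     = of_real t * (fcoef (nform (rho_F2 \<alpha> p)) i k - fcoef (nform (rho_E2 \<alpha> p)) i k)"
  "fcoef (nform (drho_rep \<alpha> (0, 0, t *\<^sub>R (sl_F - sl_E)) p)) i k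
     = of_real t * (fcoef (nform (rho_F3 p)) i k - fcoef (nform (rho_E3 p)) i k)"
  by (simp_all add: drho_rep_def sl_F_def sl_E_def nform_add nform_mult[of "sconst _"] algebra_simps)

lemma nform_drho_rep_diagonal:
  "fcoef (nform (drho_rep \<alpha> (t *\<^sub>R sl_H, 0, 0) p)) i k = of_real t * fcoef (nform (rho_H1 p)) i k"
  "fcoef (nform (drho_rep \<alpha> (0, 0, t *\<^sub>R sl_H) p)) i k = of_real t * fcoef (nform (rho_H3 p)) i k"
  by (simp_all add: drho_rep_def sl_H_def nform_add nform_mult[of "sconst _"])

lemma fock_embed_drho_eqI:
  assumes "\<And>q i k. fcoef (nform (drho_rep \<alpha> X q)) i k = fcoef (T (nform q)) i k"
  shows "fock_embed (drho \<alpha> X p) = T (fock_embed p)"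
  by (transfer fixing: \<alpha> X T) (rule fseries_eqI, rule assms)

text \<open>The columns are the eigenvectors \<open>z\<^sub>3 \<plusminus> (\<i>/2) z\<^sub>4\<close> of \<open>d\<rho>(F\<^sub>1 - E\<^sub>1)\<close>.\<close>

definition rot_mix :: "4 \<Rightarrow> 4 \<Rightarrow> complex" where
  "rot_mix i j =
     (if i = 3 \<and> j = 3 \<or> i = 3 \<and> j = 4 then 1
      else if i = 4 \<and> j = 3 then \<i> / 2 else if i = 4 \<and> j = 4 then - \<i> / 2
      else of_bool (i = j))"

definition rot_mix' :: "4 \<Rightarrow> 4 \<Rightarrow> complex" where
  "rot_mix' i j =
     (if i = 3 \<and> j = 3 \<or> i = 4 \<and> j = 3 then 1 / 2
      else if i = 3 \<and> j = 4 then - \<i> else if i = 4 \<and> j = 4 then \<i>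
      else of_bool (i = j))"

text \<open>The columns are the eigenvectors \<open>1 \<plusminus> z\<^sub>2\<close> of \<open>d\<rho>(H\<^sub>3)\<close>.\<close>

definition hyp_mix :: "4 \<Rightarrow> 4 \<Rightarrow> complex" where
  "hyp_mix i j = (if i = 2 \<and> j = 2 then -1 else if {i, j} \<subseteq> {1, 2} then 1 else of_bool (i = j))"

definition hyp_mix' :: "4 \<Rightarrow> 4 \<Rightarrow> complex" where
  "hyp_mix' i j = (if i = 2 \<and> j = 2 then - 1 / 2 else if {i, j} \<subseteq> {1, 2} then 1 / 2 else of_bool (i = j))"

section \<open>The five exponentials on coefficients\<close>

lemma rho0_exp_K1:
  assumes "\<alpha> \<notin> \<nat>" and "f \<in> fock_space \<alpha>"
  shows "fcoef (rho0_exp \<alpha> (t *\<^sub>R (sl_F - sl_E), 0, 0) f) i k =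
    (if i = 3 then of_real (cos t) * fcoef f 3 k + 2 * of_real (sin t) * fcoef f 4 k
     else if i = 4 then of_real (cos t) * fcoef f 4 k - of_real (sin t) / 2 * fcoef f 3 k
     else fcoef f i k)"
proof -
  \<comment> \<open>The eigenvalues follow the order of the columns of \<open>rot_mix\<close>; they
    are imaginary, so the bound on real parts is 0.\<close>
  define \<mu> :: "4 \<Rightarrow> nat \<Rightarrow> complex" where
    "\<mu> i k = (if i = 3 then \<i> * of_real t else if i = 4 then - \<i> * of_real t else 0)" for i k
  interpret diagonalized_generator \<alpha> "drho \<alpha> (t *\<^sub>R (sl_F - sl_E), 0, 0)" \<mu> rot_mix rot_mix' 0
  proof
    show "\<alpha> \<notin> \<nat>" by fact
    show "(\<Sum>j\<in>UNIV. rot_mix i j * rot_mix' j l) = of_bool (i = l)"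
      "(\<Sum>j\<in>UNIV. rot_mix' i j * rot_mix j l) = of_bool (i = l)" for i l
      using exhaust_4[of i] exhaust_4[of l] by (auto simp: rot_mix_def rot_mix'_def sum_4)
    show "i \<in> {1, 2} \<longleftrightarrow> j \<in> {1, 2}" if "rot_mix i j \<noteq> 0" for i j
      using that exhaust_4[of i] exhaust_4[of j] by (auto simp: rot_mix_def)
    show "i \<in> {1, 2} \<longleftrightarrow> j \<in> {1, 2}" if "rot_mix' i j \<noteq> 0" for i j
      using that exhaust_4[of i] exhaust_4[of j] by (auto simp: rot_mix'_def)
    show "\<bar>Re (\<mu> i k)\<bar> \<le> 0" for i k
      by (simp add: \<mu>_def)
    show "fock_embed (drho \<alpha> (t *\<^sub>R (sl_F - sl_E), 0, 0) p)
        = mix_op rot_mix (diag_op \<mu> (mix_op rot_mix' (fock_embed p)))" for p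
    proof (rule fock_embed_drho_eqI)
      fix q i k
      show "fcoef (nform (drho_rep \<alpha> (t *\<^sub>R (sl_F - sl_E), 0, 0) q)) i k
          = fcoef (mix_op rot_mix (diag_op \<mu> (mix_op rot_mix' (nform q)))) i k"
        unfolding nform_drho_rep_rotation fcoef_rho1 using exhaust_4[of i]
        by (auto simp: sum_4 rot_mix_def rot_mix'_def \<mu>_def algebra_simps)
    qed
  qed
  have E: "exp (\<i> * of_real t) = of_real (cos t) + \<i> * of_real (sin t)"
    "exp (- (\<i> * of_real t)) = of_real (cos t) - \<i> * of_real (sin t)"
    using exp_Euler[of "of_real t"] exp_minus_Euler[of "of_real t"] by (simp_all add: cos_of_real sin_of_real)
  then show ?thesis
    using exhaust_4[of i] unfolding rho0_exp_def fock_exp_eq[OF assms(2)]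
    by (auto simp: sum_4 rot_mix_def rot_mix'_def \<mu>_def E) (simp_all add: field_simps)
qed

text \<open>Serves K_2, K_3 and A_1, whose generators are diagonal in the monomial basis
  itself.\<close>

lemma rho0_exp_diagonal:
  assumes "\<alpha> \<notin> \<nat>" and "f \<in> fock_space \<alpha>" and "\<And>i k. \<bar>Re (\<mu> i k)\<bar> \<le> B"
    and "\<And>q i k. fcoef (nform (drho_rep \<alpha> X q)) i k = \<mu> i k * fcoef (nform q) i k"
  shows "fcoef (rho0_exp \<alpha> X f) i k = exp (\<mu> i k) * fcoef f i k"
proof -
  interpret diagonalized_generator \<alpha> "drho \<alpha> X" \<mu> id_mix id_mix B
  proof
    show "fock_embed (drho \<alpha> X p) = mix_op id_mix (diag_op \<mu> (mix_op id_mix (fock_embed p)))" for p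
      using fock_embed_drho_eqI[of \<alpha> X "diag_op \<mu>" p] assms(4) by simp
    show "i \<in> {1, 2} \<longleftrightarrow> j \<in> {1, 2}" if "id_mix i j \<noteq> 0" for i j
      using that by (auto simp: id_mix_def)
    show "(\<Sum>j\<in>UNIV. id_mix i j * id_mix j l) = of_bool (i = l)" for i l
      by (simp add: id_mix_def of_bool_def sum.delta if_distrib[of "\<lambda>y. y * _"] cong: if_cong)
  qed (use assms in auto)
  show ?thesis
    by (simp add: rho0_exp_def fock_exp_eq assms(2) del: fcoef_mix_op)
qed

lemma rho0_exp_A3:
  assumes "\<alpha> \<notin> \<nat>" and "f \<in> fock_space \<alpha>"
  shows "fcoef (rho0_exp \<alpha> (0, 0, t *\<^sub>R sl_H) f) i k =
    (if i = 1 then of_real (cosh t) * fcoef f 1 k + of_real (sinh t) * fcoef f 2 k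
     else if i = 2 then of_real (sinh t) * fcoef f 1 k + of_real (cosh t) * fcoef f 2 k
     else fcoef f i k)"
proof -
  define \<mu> :: "4 \<Rightarrow> nat \<Rightarrow> complex" where
    "\<mu> i k = (if i = 1 then of_real t else if i = 2 then - of_real t else 0)" for i k
  interpret diagonalized_generator \<alpha> "drho \<alpha> (0, 0, t *\<^sub>R sl_H)" \<mu> hyp_mix hyp_mix' "\<bar>t\<bar>"
  proof
    show "\<alpha> \<notin> \<nat>" by fact
    show "(\<Sum>j\<in>UNIV. hyp_mix i j * hyp_mix' j l) = of_bool (i = l)"
      "(\<Sum>j\<in>UNIV. hyp_mix' i j * hyp_mix j l) = of_bool (i = l)" for i l
      using exhaust_4[of i] exhaust_4[of l] by (auto simp: hyp_mix_def hyp_mix'_def sum_4)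
    show "i \<in> {1, 2} \<longleftrightarrow> j \<in> {1, 2}" if "hyp_mix i j \<noteq> 0" for i j
      using that exhaust_4[of i] exhaust_4[of j] by (auto simp: hyp_mix_def)
    show "i \<in> {1, 2} \<longleftrightarrow> j \<in> {1, 2}" if "hyp_mix' i j \<noteq> 0" for i j
      using that exhaust_4[of i] exhaust_4[of j] by (auto simp: hyp_mix'_def)
    show "\<bar>Re (\<mu> i k)\<bar> \<le> \<bar>t\<bar>" for i k
      by (simp add: \<mu>_def)
    show "fock_embed (drho \<alpha> (0, 0, t *\<^sub>R sl_H) p)
        = mix_op hyp_mix (diag_op \<mu> (mix_op hyp_mix' (fock_embed p)))" for p
    proof (rule fock_embed_drho_eqI)
      fix q i k
      show "fcoef (nform (drho_rep \<alpha> (0, 0, t *\<^sub>R sl_H) q)) i k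
          = fcoef (mix_op hyp_mix (diag_op \<mu> (mix_op hyp_mix' (nform q)))) i k"
        unfolding nform_drho_rep_diagonal fcoef_rho_H3 using exhaust_4[of i]
        by (auto simp: sum_4 hyp_mix_def hyp_mix'_def \<mu>_def algebra_simps)
    qed
  qed
  have E: "exp (- complex_of_real t) = of_real (exp (- t))"
    by (simp flip: of_real_minus add: exp_of_real)
  show ?thesis
    using exhaust_4[of i] unfolding rho0_exp_def fock_exp_eq[OF assms(2)]
    by (auto simp: E sum_4 hyp_mix_def hyp_mix'_def \<mu>_def cosh_field_def sinh_field_def exp_of_real
        field_simps)
qed

section \<open>Matrix exponentials\<close>

lemma mat_exp_rotation: "mat_exp (t *\<^sub>R (sl_F - sl_E)) = rotation_mat t"
proof -
  \<comment> \<open>F - E squares to minus the identity. Writing the periodic signs as n! times the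
    Taylor coefficients of cosine and sine makes the exponential series split into theirs.\<close>
  have "((\<lambda>B. t *\<^sub>R (sl_F - sl_E) ** B) ^^ n) (mat 1)
     = (fact n * cos_coeff n * t ^ n) *\<^sub>R mat 1 + (fact n * sin_coeff n * t ^ n) *\<^sub>R (sl_F - sl_E)" for n
  proof (induction n)
    case (Suc n)
    have *: "fact (Suc n) * cos_coeff (Suc n) * t ^ Suc n = - (fact n * sin_coeff n * t ^ n * t)"
      "fact (Suc n) * sin_coeff (Suc n) * t ^ Suc n = fact n * cos_coeff n * t ^ n * t"
      by (simp_all add: cos_coeff_Suc sin_coeff_Suc field_simps del: of_nat_Suc)
    show ?case
      unfolding funpow.simps o_apply Suc.IH *
      by (simp add: vec_eq_iff forall_2 sl_F_def sl_E_def matrix_matrix_mult_def sum_2 mat_def)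
  qed (simp add: mat_def cos_coeff_def sin_coeff_def)
  then have pow: "(1 / fact n) *\<^sub>R (((\<lambda>B. t *\<^sub>R (sl_F - sl_E) ** B) ^^ n) (mat 1))
     = (cos_coeff n *\<^sub>R t ^ n) *\<^sub>R mat 1 + (sin_coeff n *\<^sub>R t ^ n) *\<^sub>R (sl_F - sl_E)" for n
    by (simp add: scaleR_add_right)
  have "(\<lambda>n. (1 / fact n) *\<^sub>R (((\<lambda>B. t *\<^sub>R (sl_F - sl_E) ** B) ^^ n) (mat 1)))
      sums (cos t *\<^sub>R mat 1 + sin t *\<^sub>R (sl_F - sl_E))"
    unfolding pow
    by (intro sums_add bounded_linear.sums[OF bounded_linear_scaleR_left] cos_converges sin_converges)
  then show ?thesis
    unfolding mat_exp_def rotation_mat_def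
    by (simp add: sums_iff vec_eq_iff forall_2 sl_F_def sl_E_def mat_def)
qed

lemma mat_exp_0: "mat_exp 0 = mat 1"
  using mat_exp_rotation[of 0] by (simp add: rotation_mat_def vec_eq_iff forall_2 mat_def)

lemma mat_exp_diagonal: "mat_exp (a *\<^sub>R sl_H) = diagonal_mat a"
proof -
  \<comment> \<open>H = P - Q with complementary idempotents, so the powers of a H act as powers of
    a and -a on the two parts.\<close>
  define P Q :: mat2 where "P = vector [vector [1, 0], vector [0, 0]]" and "Q = vector [vector [0, 0], vector [0, 1]]"
  have pow: "(1 / fact n) *\<^sub>R (((\<lambda>B. a *\<^sub>R sl_H ** B) ^^ n) (mat 1))
     = (a ^ n /\<^sub>R fact n) *\<^sub>R P + ((- a) ^ n /\<^sub>R fact n) *\<^sub>R Q" for n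
  proof -
    have "((\<lambda>B. a *\<^sub>R sl_H ** B) ^^ n) (mat 1) = a ^ n *\<^sub>R P + (- a) ^ n *\<^sub>R Q"
    proof (induction n)
      case 0
      show ?case
        by (simp add: P_def Q_def vec_eq_iff forall_2 mat_def)
    next
      case (Suc n)
      then show ?case
        by (simp add: P_def Q_def vec_eq_iff forall_2 sl_H_def matrix_matrix_mult_def sum_2)
    qed
    then show ?thesis
      by (simp add: scaleR_add_right divide_inverse)
  qed
  have "(\<lambda>n. (1 / fact n) *\<^sub>R (((\<lambda>B. a *\<^sub>R sl_H ** B) ^^ n) (mat 1))) sums (exp a *\<^sub>R P + exp (- a) *\<^sub>R Q)"
    unfolding pow
    by (intro sums_add bounded_linear.sums[OF bounded_linear_scaleR_left] exp_converges)
  then show ?thesis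
    unfolding mat_exp_def diagonal_mat_def
    by (simp add: sums_iff vec_eq_iff forall_2 P_def Q_def)
qed

section \<open>Comparison with the substitution formulas\<close>

lemma nform_linear:
  "nform (sconst a + sconst b * z2) = FSeries (fps_const a) (fps_const b) 0 0"
  "nform (sconst b * z2) = FSeries 0 (fps_const b) 0 0"
  "nform z2 = FSeries 0 1 0 0"
  "nform (sconst a * z3) = FSeries 0 0 (fps_const a) 0"
  "nform (sconst b * z4) = FSeries 0 0 0 (fps_const b)"
  "nform (sconst a * z3 + sconst b * z4) = FSeries 0 0 (fps_const a) (fps_const b)"
  "nform (sconst a * z3 - sconst b * z4) = FSeries 0 0 (fps_const a) (- fps_const b)"
  by (simp_all add: nform_def sconst_def z2_def z3_def z4_def spoly_ops fps_of_poly_const)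

theorem theorem5p1:
  fixes \<alpha> k1 k2 k3 a1 a3 :: real and f :: fseries
  assumes "\<alpha> \<notin> \<nat>" and "f \<in> fock_space \<alpha>"
  shows
    "let
       fK1 = fsubst f fps_X z2
               (sconst (cos k1) * z3 - sconst (sin k1 / 2) * z4)
               (sconst (2 * sin k1) * z3 + sconst (cos k1) * z4);
       fK2 = nform (sconst (exp (\<i> * \<alpha> * k2))) *
             fsubst f (fps_const (exp (- 2 * \<i> * k2)) * fps_X) z2
               (sconst (exp (- \<i> * k2)) * z3) (sconst (exp (- \<i> * k2)) * z4);
       fK3 = nform (sconst (exp (\<i> * k3))) *
             fsubst f fps_X (sconst (exp (- 2 * \<i> * k3)) * z2)
               (sconst (exp (- \<i> * k3)) * z3) (sconst (exp (- \<i> * k3)) * z4);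
       fA1 = fsubst f fps_X z2 (sconst (exp (- a1)) * z3) (sconst (exp a1) * z4);
       fA3 = nform (sconst (cosh a3) + sconst (sinh a3) * z2) *
             fsubst f fps_X (sconst (tanh a3) + sconst (1 / (cosh a3)\<^sup>2) * z2)
               (sconst (1 / cosh a3) * z3) (sconst (1 / cosh a3) * z4)
     in
       (rho0_exp \<alpha> (k1 *\<^sub>R (sl_F - sl_E), 0, 0) f = fK1 \<and>
        rho0_exp \<alpha> (0, k2 *\<^sub>R (sl_F - sl_E), 0) f = fK2 \<and>
        rho0_exp \<alpha> (0, 0, k3 *\<^sub>R (sl_F - sl_E)) f = fK3 \<and>
        rho0_exp \<alpha> (a1 *\<^sub>R sl_H, 0, 0) f = fA1 \<and>
        rho0_exp \<alpha> (0, 0, a3 *\<^sub>R sl_H) f = fA3) \<and>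
       (\<forall>\<rho>. is_rho0 \<alpha> \<rho> \<longrightarrow>
          \<rho> (K1 k1) f = fK1 \<and> \<rho> (K2 k2) f = fK2 \<and> \<rho> (K3 k3) f = fK3 \<and>
          \<rho> (A1 a1) f = fA1 \<and> \<rho> (A3 a3) f = fA3)"
proof -
  define fK1 where "fK1 = fsubst f fps_X z2
               (sconst (cos k1) * z3 - sconst (sin k1 / 2) * z4)
               (sconst (2 * sin k1) * z3 + sconst (cos k1) * z4)"
  define fK2 where "fK2 = nform (sconst (exp (\<i> * \<alpha> * k2))) *
             fsubst f (fps_const (exp (- 2 * \<i> * k2)) * fps_X) z2
               (sconst (exp (- \<i> * k2)) * z3) (sconst (exp (- \<i> * k2)) * z4)"
  define fK3 where "fK3 = nform (sconst (exp (\<i> * k3))) *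
             fsubst f fps_X (sconst (exp (- 2 * \<i> * k3)) * z2)
               (sconst (exp (- \<i> * k3)) * z3) (sconst (exp (- \<i> * k3)) * z4)"
  define fA1 where "fA1 = fsubst f fps_X z2 (sconst (exp (- a1)) * z3) (sconst (exp a1) * z4)"
  define fA3 where "fA3 = nform (sconst (cosh a3) + sconst (sinh a3) * z2) *
             fsubst f fps_X (sconst (tanh a3) + sconst (1 / (cosh a3)\<^sup>2) * z2)
               (sconst (1 / cosh a3) * z3) (sconst (1 / cosh a3) * z4)"
  note fcoef_4 = fcoef_simps fsubst_def nform_linear nform_sconst fseries_ops
  have K1: "rho0_exp \<alpha> (k1 *\<^sub>R (sl_F - sl_E), 0, 0) f = fK1"
  proof (rule fseries_eqI)
    fix i k
    show "fcoef (rho0_exp \<alpha> (k1 *\<^sub>R (sl_F - sl_E), 0, 0) f) i k = fcoef fK1 i k"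
      unfolding rho0_exp_K1[OF assms] fK1_def using exhaust_4[of i] by (auto simp: fcoef_4)
  qed
  have K2: "rho0_exp \<alpha> (0, k2 *\<^sub>R (sl_F - sl_E), 0) f = fK2"
  proof (rule fseries_eqI)
    fix i k
    define \<mu> :: "4 \<Rightarrow> nat \<Rightarrow> complex" where
      "\<mu> i k = of_real k2 * (- \<i> * (2 * of_nat k - of_real \<alpha> + of_bool (i = 3 \<or> i = 4)))" for i k
    \<comment> \<open>The factors come from the three summands of the eigenvalue: -\<alpha> gives
      the scalar in front, 2 k the rescaling of z_1, and the odd summand 1 the rescaling of z_3 and
      z_4.\<close>
    have exp_\<mu>: "exp (\<mu> i k) = exp (\<i> * \<alpha> * k2) * (exp (- 2 * \<i> * k2) ^ k
        * (if i = 3 \<or> i = 4 then exp (- \<i> * k2) else 1))"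
      unfolding \<mu>_def exp_of_nat_mult[symmetric] by (simp add: algebra_simps flip: exp_add)
    have "fcoef (rho0_exp \<alpha> (0, k2 *\<^sub>R (sl_F - sl_E), 0) f) i k = exp (\<mu> i k) * fcoef f i k"
    proof (rule rho0_exp_diagonal[OF assms, of _ 0])
      show "\<bar>Re (\<mu> i k)\<bar> \<le> 0" for i k
        by (simp add: \<mu>_def)
    qed (simp add: nform_drho_rep_rotation fcoef_rho_rot \<mu>_def mult.assoc)
    then show "fcoef (rho0_exp \<alpha> (0, k2 *\<^sub>R (sl_F - sl_E), 0) f) i k = fcoef fK2 i k"
      unfolding exp_\<mu> fK2_def using exhaust_4[of i] by (auto simp: fcoef_4)
  qed
  have K3: "rho0_exp \<alpha> (0, 0, k3 *\<^sub>R (sl_F - sl_E)) f = fK3"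
  proof (rule fseries_eqI)
    fix i k
    define \<mu> :: "4 \<Rightarrow> nat \<Rightarrow> complex" where
      "\<mu> i k = of_real k3 * (- \<i> * (if i = 1 then -1 else if i = 2 then 1 else 0))" for i k
    have exp_\<mu>: "exp (\<mu> i k) = exp (\<i> * k3)
        * (if i = 1 then 1 else if i = 2 then exp (- 2 * \<i> * k3) else exp (- \<i> * k3))"
      unfolding \<mu>_def by (simp add: algebra_simps flip: exp_add)
    have "fcoef (rho0_exp \<alpha> (0, 0, k3 *\<^sub>R (sl_F - sl_E)) f) i k = exp (\<mu> i k) * fcoef f i k"
    proof (rule rho0_exp_diagonal[OF assms, of _ 0])
      show "\<bar>Re (\<mu> i k)\<bar> \<le> 0" for i k
        by (simp add: \<mu>_def)
    qed (simp add: nform_drho_rep_rotation fcoef_rho_rot \<mu>_def mult.assoc)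
    then show "fcoef (rho0_exp \<alpha> (0, 0, k3 *\<^sub>R (sl_F - sl_E)) f) i k = fcoef fK3 i k"
      unfolding exp_\<mu> fK3_def using exhaust_4[of i] by (auto simp: fcoef_4)
  qed
  have A1: "rho0_exp \<alpha> (a1 *\<^sub>R sl_H, 0, 0) f = fA1"
  proof (rule fseries_eqI)
    fix i k
    define \<mu> :: "4 \<Rightarrow> nat \<Rightarrow> complex" where
      "\<mu> i k = of_real (if i = 3 then - a1 else if i = 4 then a1 else 0)" for i k
    have "fcoef (rho0_exp \<alpha> (a1 *\<^sub>R sl_H, 0, 0) f) i k = exp (\<mu> i k) * fcoef f i k"
    proof (rule rho0_exp_diagonal[OF assms, of _ "\<bar>a1\<bar>"])
      show "\<bar>Re (\<mu> i k)\<bar> \<le> \<bar>a1\<bar>" for i k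
        by (simp add: \<mu>_def)
    qed (auto simp: nform_drho_rep_diagonal fcoef_rho1 \<mu>_def)
    then show "fcoef (rho0_exp \<alpha> (a1 *\<^sub>R sl_H, 0, 0) f) i k = fcoef fA1 i k"
      unfolding fA1_def \<mu>_def exp_of_real using exhaust_4[of i] by (auto simp: fcoef_4)
  qed
  have A3: "rho0_exp \<alpha> (0, 0, a3 *\<^sub>R sl_H) f = fA3"
  proof (rule fseries_eqI)
    fix i k
    have "cosh a3 \<noteq> 0"
      using cosh_real_pos[of a3] by simp
    then have c: "complex_of_real (cosh a3) \<noteq> 0"
      by simp
    \<comment> \<open>In \<open>fA3\<close> the coefficient of z_2 receives \<open>fs2 f\<close>
      with the factor 1 / cosh + sinh * tanh, which equals cosh by this identity. On z_3 and z_4 the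
      factor cosh cancels, since z_2 annihilates them.\<close>
    have "complex_of_real ((cosh a3)\<^sup>2) = of_real ((sinh a3)\<^sup>2 + 1)"
      unfolding cosh_square_eq ..
    then have cosh_sq: "of_real (cosh a3) * (of_real (cosh a3) * x) = x + of_real (sinh a3) * (of_real (sinh a3) * x)"
      for x :: complex
      by (simp add: power2_eq_square algebra_simps)
    show "fcoef (rho0_exp \<alpha> (0, 0, a3 *\<^sub>R sl_H) f) i k = fcoef fA3 i k"
      unfolding rho0_exp_A3[OF assms] fA3_def using exhaust_4[of i] c
      by (auto simp: fcoef_4 tanh_def field_simps power2_eq_square cosh_sq)
  qed
  have tr: "trace (t *\<^sub>R (sl_F - sl_E)) = 0" "trace (t *\<^sub>R sl_H) = 0" "trace (0 :: mat2) = 0" for t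
    by (simp_all add: trace_def sum_2 sl_F_def sl_E_def sl_H_def)
  have "\<rho> (K1 k1) f = fK1 \<and> \<rho> (K2 k2) f = fK2 \<and> \<rho> (K3 k3) f = fK3 \<and>
      \<rho> (A1 a1) f = fA1 \<and> \<rho> (A3 a3) f = fA3" if "is_rho0 \<alpha> \<rho>" for \<rho>
  proof -
    \<comment> \<open>All five group elements are exponentials of even elements, so the values of
      \<rho> there are forced by \<open>rho0_exp\<close>.\<close>
    have *: "\<rho> (G0_exp X) f = rho0_exp \<alpha> X f" if "X \<in> even_part" for X
      using \<open>is_rho0 \<alpha> \<rho>\<close> assms(2) that by (simp add: is_rho0_def)
    have "(t *\<^sub>R (sl_F - sl_E), 0, 0) \<in> even_part" "(0, t *\<^sub>R (sl_F - sl_E), 0) \<in> even_part"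
      "(0, 0, t *\<^sub>R (sl_F - sl_E)) \<in> even_part" "(t *\<^sub>R sl_H, 0, 0) \<in> even_part"
      "(0, 0, t *\<^sub>R sl_H) \<in> even_part" for t
      unfolding even_part_def using tr by blast+
    from this[THEN *] show ?thesis
      unfolding K1 K2 K3 A1 A3 K1_def K2_def K3_def A1_def A3_def G0_exp_def case_prod_conv
        mat_exp_rotation mat_exp_diagonal mat_exp_0
      by (metis K1 K2 K3 A1 A3)
  qed
  then show ?thesis
    unfolding Let_def fK1_def[symmetric] fK2_def[symmetric] fK3_def[symmetric]
      fA1_def[symmetric] fA3_def[symmetric]
    using K1 K2 K3 A1 A3 by blast
qed

end
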